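(* Suppose $F=\{f_1,\ldots,f_n\}\subset\mathbb{C}[x_1,\ldots,x_n]$ is a polynomial system which has $\hat{\mathbf{x}}_e\in\mathbb{C}^n$ as an isolated exact singular solution with multiplicity $\mu$, and the corank of the Jacobian $F'(\hat{\mathbf{x}}_e)$ is one. Let $\mathbf{r}_1$ be the null vector of $F'(\hat{\mathbf{x}}_e)$ with $\|\mathbf{r}_1\|=1$. For any random vector $\mathbf{h}\in\mathbb{C}^n$ satisfying $\mathbf{h}^*\mathbf{r}_1\neq 0$, the augmented polynomial system in the $2n$ variables $(\mathbf{x},\nu)$, $\nu=[\nu_1,\ldots,\nu_n]^T$, $$J(\mathbf{x},\nu):=\left\{\begin{array}{l}F(\mathbf{x}),\\ F'(\mathbf{x})\cdot\nu,\\ \mathbf{h}^*\nu-1,\end{array}\right.$$ has $\left(\hat{\mathbf{x}}_e,\frac{\mathbf{r}_1}{\mathbf{h}^*\mathbf{r}_1}\right)$ as an isolated singular solution with multiplicity $\mu-1$.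
   Context: $\mathbf{h}^*$ denotes the conjugate transpose of $\mathbf{h}$, and $\|\cdot\|$ is the $l^2$-norm. The multiplicity of an isolated solution of a (possibly overdetermined) polynomial system is $\dim_{\mathbb{C}}$ of the quotient of the polynomial ring by the isolated primary component, at the maximal ideal of that point, of the ideal generated by the system. The corank of a matrix is the dimension of its null space.
   Formalization: The new solution is claimed to be singular only when μ−1 > 1: for μ = 2 it is a simple solution (e.g. n = 1, f = x²), so singularity fails there; isolatedness and multiplicity μ−1 are claimed in all cases. *)

theory Defs
  imports "HOL-Analysis.Analysis" "HOL-Library.Poly_Mapping"
begin

section \<open>Complex polynomials in finitely many variables\<close>

text \<open>The variables are indexed by a finite type \<open>'v\<close>; a polynomial maps exponent vectors to
  coefficients, and multiplication is the convolution product of \<^typ>\<open>'a \<Rightarrow>\<^sub>0 'b\<close>.\<close>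

type_synonym 'v cpoly = "('v \<Rightarrow>\<^sub>0 nat) \<Rightarrow>\<^sub>0 complex"

definition Const :: "complex \<Rightarrow> 'v cpoly"
  where "Const c = Poly_Mapping.single 0 c"

definition Var :: "'v \<Rightarrow> 'v cpoly"
  where "Var v = Poly_Mapping.single (Poly_Mapping.single v 1) 1"

text \<open>The substitution \<open>v \<mapsto> f v\<close>, with coefficients mapped by \<open>\<phi>\<close>.\<close>

definition cpoly_subst ::
    "(complex \<Rightarrow> 'r::comm_ring_1) \<Rightarrow> ('v::finite \<Rightarrow> 'r) \<Rightarrow> 'v cpoly \<Rightarrow> 'r"
  where "cpoly_subst \<phi> f p =
    (\<Sum>m\<in>Poly_Mapping.keys p. \<phi> (Poly_Mapping.lookup p m) * (\<Prod>v\<in>UNIV. f v ^ Poly_Mapping.lookup m v))"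

definition cpoly_eval :: "complex ^ 'v::finite \<Rightarrow> 'v cpoly \<Rightarrow> complex"
  where "cpoly_eval x p = cpoly_subst (\<lambda>c. c) (\<lambda>v. x $ v) p"

text \<open>If the exponent of \<open>v\<close> in \<open>m\<close> is 0, the truncated subtraction is harmless because the
  coefficient vanishes.\<close>

definition cpoly_deriv :: "'v \<Rightarrow> 'v cpoly \<Rightarrow> 'v cpoly"
  where "cpoly_deriv v p =
    (\<Sum>m\<in>Poly_Mapping.keys p. Poly_Mapping.single (m - Poly_Mapping.single v 1)
        (of_nat (Poly_Mapping.lookup m v) * Poly_Mapping.lookup p m))"


section \<open>Primary decomposition\<close>

text \<open>Ideals of a commutative ring are the submodules of the ring over itself;
  \<open>ideal.span S\<close> is the ideal generated by \<open>S\<close>.\<close>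

global_interpretation ideal: module "(*) :: 'a::comm_ring_1 \<Rightarrow> 'a \<Rightarrow> 'a"
  by standard (simp_all add: algebra_simps)

definition radical :: "'a::comm_ring_1 set \<Rightarrow> 'a set"
  where "radical I = {a. \<exists>k. a ^ k \<in> I}"

definition primary_ideal :: "'a::comm_ring_1 set \<Rightarrow> bool"
  where "primary_ideal Q \<longleftrightarrow>
    ideal.subspace Q \<and> 1 \<notin> Q \<and> (\<forall>a b. a * b \<in> Q \<longrightarrow> a \<in> Q \<or> b \<in> radical Q)"

definition minimal_primary_decomposition :: "'a::comm_ring_1 set \<Rightarrow> 'a set set \<Rightarrow> bool"
  where "minimal_primary_decomposition I D \<longleftrightarrow>
    finite D \<and> (\<forall>Q\<in>D. primary_ideal Q) \<and> \<Inter>D = I \<and>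
    inj_on radical D \<and> (\<forall>Q\<in>D. \<Inter>(D - {Q}) \<noteq> I)"

text \<open>\<open>Q\<close> is the primary component of \<open>I\<close> belonging to \<open>P\<close>, and \<open>P\<close> is minimal among the
  associated primes of \<open>I\<close>. Such a \<open>Q\<close> does not depend on the decomposition.\<close>

definition isolated_primary_component :: "'a::comm_ring_1 set \<Rightarrow> 'a set \<Rightarrow> 'a set \<Rightarrow> bool"
  where "isolated_primary_component I P Q \<longleftrightarrow>
    (\<exists>D. minimal_primary_decomposition I D \<and> Q \<in> D \<and> radical Q = P \<and>
         (\<forall>Q'\<in>D. \<not> radical Q' \<subset> P))"


section \<open>Solutions of polynomial systems\<close>

text \<open>\<open>d\<close> is the dimension over \<open>\<complex>\<close> of the quotient by \<open>Q\<close>: the cosets of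
  \<open>b 0, \<dots>, b (d - 1)\<close> form a basis of it.\<close>

definition has_quotient_dim :: "'v cpoly set \<Rightarrow> nat \<Rightarrow> bool"
  where "has_quotient_dim Q d \<longleftrightarrow>
    (\<exists>b :: nat \<Rightarrow> 'v cpoly. \<forall>p. \<exists>!c :: nat \<Rightarrow> complex.
        (\<forall>i\<ge>d. c i = 0) \<and> p - (\<Sum>i<d. Const (c i) * b i) \<in> Q)"

definition maximal_ideal_at :: "complex ^ 'v::finite \<Rightarrow> 'v cpoly set"
  where "maximal_ideal_at x = {p. cpoly_eval x p = 0}"

definition isolated_solution :: "('e \<Rightarrow> 'v::finite cpoly) \<Rightarrow> complex ^ 'v \<Rightarrow> bool"
  where "isolated_solution F x \<longleftrightarrow> x isolated_in {y. \<forall>i. cpoly_eval y (F i) = 0}"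

definition has_multiplicity :: "('e \<Rightarrow> 'v::finite cpoly) \<Rightarrow> complex ^ 'v \<Rightarrow> nat \<Rightarrow> bool"
  where "has_multiplicity F x \<mu> \<longleftrightarrow>
    (\<exists>Q. isolated_primary_component (ideal.span (F ` UNIV)) (maximal_ideal_at x) Q \<and>
         has_quotient_dim Q \<mu>)"

definition jacobian_at ::
    "('e::finite \<Rightarrow> 'v::finite cpoly) \<Rightarrow> complex ^ 'v \<Rightarrow> complex ^ 'v ^ 'e"
  where "jacobian_at F x = (\<chi> i j. cpoly_eval x (cpoly_deriv j (F i)))"

definition corank :: "complex ^ 'v::finite ^ 'e::finite \<Rightarrow> nat"
  where "corank A = vec.dim {v. A *v v = 0}"

text \<open>For a possibly overdetermined system, singular means that the Jacobian does not have full
  column rank.\<close>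

definition singular_at :: "('e::finite \<Rightarrow> 'v::finite cpoly) \<Rightarrow> complex ^ 'v \<Rightarrow> bool"
  where "singular_at F x \<longleftrightarrow> corank (jacobian_at F x) > 0"


section \<open>The augmented system\<close>

text \<open>\<open>h\<^sup>* v\<close>, conjugate-linear in the first argument.\<close>

definition hermitian_prod :: "complex ^ 'v::finite \<Rightarrow> complex ^ 'v \<Rightarrow> complex"
  where "hermitian_prod h v = (\<Sum>i\<in>UNIV. cnj (h $ i) * v $ i)"

text \<open>The variables of the augmented system are indexed by \<^typ>\<open>'n + 'n\<close>: \<open>Inl j\<close> stands for
  \<open>x\<^sub>j\<close> and \<open>Inr j\<close> for \<open>\<nu>\<^sub>j\<close>. Its equations are indexed by
  \<^typ>\<open>'n + 'n + unit\<close>, one summand for each of its three blocks.\<close>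

definition in_x :: "'n::finite cpoly \<Rightarrow> ('n + 'n) cpoly"
  where "in_x p = cpoly_subst Const (\<lambda>j. Var (Inl j)) p"

definition join :: "complex ^ 'n::finite \<Rightarrow> complex ^ 'n \<Rightarrow> complex ^ ('n + 'n)"
  where "join x v = (\<chi> k. case k of Inl j \<Rightarrow> x $ j | Inr j \<Rightarrow> v $ j)"

definition augmented_system ::
    "('n::finite \<Rightarrow> 'n cpoly) \<Rightarrow> complex ^ 'n \<Rightarrow> 'n + 'n + unit \<Rightarrow> ('n + 'n) cpoly"
  where "augmented_system F h e = (case e of
      Inl i \<Rightarrow> in_x (F i)
    | Inr (Inl i) \<Rightarrow> \<Sum>j\<in>UNIV. in_x (cpoly_deriv j (F i)) * Var (Inr j)
    | Inr (Inr _) \<Rightarrow> (\<Sum>j\<in>UNIV. Const (cnj (h $ j)) * Var (Inr j)) - 1)"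

end

(* A solution of corank one has embedding dimension one: by Nakayama's lemma its local ring is
   generated by the single linear form l = h^*(x - xe), so modulo the primary component Q the
   coordinates are polynomials X_j(l), and Q consists of the p with t^mu dividing p(X(t)).
   Along this curve the augmented system is solved by nu = X'(t) modulo t^(mu-1). Conversely
   p -> sum_j (d_j p) nu_j is a derivation d that maps Q into the local ideal of the augmented system,
   where d l = h^* nu = 1. Applied to x_j - X_j(l) and to l^mu it gives nu_j = X_j'(l) and
   l^(mu-1) = 0, so the new local ring is C[t]/(t^(mu-1)). Topological isolatedness follows because
   an element not vanishing at the solution multiplies this primary component into the ideal. *)

theory Submission
  imports Defs
begin

text \<open>Multiplicity refers to a primary decomposition of the global ideal, whereas all
  information about the solution is local. Fractions are avoided: an element belongs to a local
  ideal if some multiplier not vanishing at the point moves it into the global ideal. Getting from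
  there to a primary component takes one multiplier for all elements at once and the existence of
  some minimal decomposition. Both rest on the ascending chain condition, hence on Hilbert's basis
  theorem. The multiplicity \<open>\<mu>\<close> comes with an arbitrary basis, so identifying it
  with the nilpotency exponent of \<open>l\<close> needs invariance of the dimension. The
  \<open>X j\<close> can be polynomials instead of power series because a power of \<open>l\<close>
  lies in \<open>Q\<close>. That \<open>\<mu>\<close> is at least 2 must be proved: the equations
  vanish to second order along the line through \<open>xe\<close> in direction \<open>r1\<close>,
  but \<open>l\<close> does not. If \<open>\<mu>\<close> is 2, the new local ring is the field of
  complex numbers and the new solution is regular; this is why singularity is claimed only for
  \<open>\<mu> - 1 > 1\<close>.\<close>

declare ideal.scale_scale [simp del] \<comment> \<open>it loops with associativity\<close>

section \<open>Primary decomposition in Noetherian rings\<close>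

text \<open>The larger ideal comes first, so that well-foundedness of this relation is the ascending
  chain condition.\<close>

definition ideal_supset :: "('a::comm_ring_1 set \<times> 'a set) set"
  where "ideal_supset = {(J, I). ideal.subspace I \<and> ideal.subspace J \<and> I \<subset> J}"

lemma ideal_mult_right:
  "ideal.subspace I \<Longrightarrow> a \<in> I \<Longrightarrow> a * b \<in> (I :: 'a::comm_ring_1 set)"
  using ideal.subspace_scale[of I a b] by (simp add: mult.commute)

lemma ideal_power_mono:
  assumes "ideal.subspace (I :: 'a::comm_ring_1 set)" "a ^ k \<in> I" "k \<le> n"
  shows "a ^ n \<in> I"
  using ideal_mult_right[OF assms(1,2), of "a ^ (n - k)"] assms(3)
  by (simp flip: power_add)

lemma ideal_colon:
  assumes "ideal.subspace (I :: 'a::comm_ring_1 set)"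
  shows "ideal.subspace {a. s * a \<in> I}"
proof (rule ideal.subspaceI)
  show "0 \<in> {a. s * a \<in> I}" using ideal.subspace_0[OF assms] by simp
  show "x + y \<in> {a. s * a \<in> I}" if "x \<in> {a. s * a \<in> I}" "y \<in> {a. s * a \<in> I}" for x y
    using ideal.subspace_add[OF assms] that by (simp add: distrib_left)
  show "c * x \<in> {a. s * a \<in> I}" if "x \<in> {a. s * a \<in> I}" for c x
    using ideal.subspace_scale[OF assms, of "s * x" c] that by (simp add: ac_simps)
qed

lemma ideal_add_principal:
  assumes "ideal.subspace (I :: 'a::comm_ring_1 set)"
  shows "ideal.subspace {i + c * a | i c. i \<in> I}" "I \<subseteq> {i + c * a | i c. i \<in> I}"
    "a \<in> {i + c * a | i c. i \<in> I}"
proof -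
  show "ideal.subspace {i + c * a | i c. i \<in> I}"
  proof (rule ideal.subspaceI)
    show "0 \<in> {i + c * a | i c. i \<in> I}"
      using ideal.subspace_0[OF assms] by (auto intro!: exI[of _ 0])
  next
    fix x y assume "x \<in> {i + c * a | i c. i \<in> I}" "y \<in> {i + c * a | i c. i \<in> I}"
    then obtain i c j d where "x = i + c * a" "y = j + d * a" "i \<in> I" "j \<in> I" by blast
    then have "x + y = (i + j) + (c + d) * a" "i + j \<in> I"
      using ideal.subspace_add[OF assms] by (simp_all add: algebra_simps)
    then show "x + y \<in> {i + c * a | i c. i \<in> I}" by blast
  next
    fix e x assume "x \<in> {i + c * a | i c. i \<in> I}"
    then obtain i c where "x = i + c * a" "i \<in> I" by blast
    then have "e * x = e * i + (e * c) * a" "e * i \<in> I"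
      using ideal.subspace_scale[OF assms, of i e] by (simp_all add: algebra_simps)
    then show "e * x \<in> {i + c * a | i c. i \<in> I}" by blast
  qed
  have "x = x + 0 * a" for x by simp
  then show "I \<subseteq> {i + c * a | i c. i \<in> I}" by blast
  have "a = 0 + 1 * a" by simp
  then show "a \<in> {i + c * a | i c. i \<in> I}" using ideal.subspace_0[OF assms] by blast
qed

lemma noetherian_maximal:
  assumes "wf (ideal_supset :: ('a::comm_ring_1 set \<times> 'a set) set)"
    and "S \<noteq> {}" and "\<And>I. I \<in> S \<Longrightarrow> ideal.subspace (I :: 'a set)"
  shows "\<exists>I\<in>S. \<forall>J\<in>S. I \<subseteq> J \<longrightarrow> J = I"
proof -
  obtain I where I: "I \<in> S" "\<And>J. (J, I) \<in> ideal_supset \<Longrightarrow> J \<notin> S"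
    using wfE_min'[OF assms(1,2)] by metis
  have "J = I" if "J \<in> S" "I \<subseteq> J" for J
    using I(2)[of J] I(1) that assms(3) unfolding ideal_supset_def by blast
  with I(1) show ?thesis by blast
qed

text \<open>Noetherian induction: a proper ideal that is not primary is the intersection of two
  strictly larger ideals, \<open>I + (a)\<close> and \<open>I + (b ^ k)\<close>, for a sufficiently
  large \<open>k\<close>.\<close>

lemma primary_decomposition_exists:
  assumes wf: "wf (ideal_supset :: ('a::comm_ring_1 set \<times> 'a set) set)"
    and "ideal.subspace (I :: 'a set)"
  shows "\<exists>D. finite D \<and> (\<forall>Q\<in>D. primary_ideal Q) \<and> \<Inter>D = I"
  using assms(2)
proof (induction I rule: wf_induct_rule[OF wf])
  case (1 I)
  note I = "1.prems"
  consider "1 \<in> I" | "primary_ideal I" |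
    (split) a b where "1 \<notin> I" "a * b \<in> I" "a \<notin> I" "b \<notin> radical I"
    using I unfolding primary_ideal_def by blast
  then show ?case
  proof cases
    case 1
    \<comment> \<open>The unit ideal is the intersection of the empty family.\<close>
    have "I = UNIV" using ideal.subspace_scale[OF I 1] by auto
    then show ?thesis by (intro exI[of _ "{}"]) auto
  next
    case 2
    then show ?thesis by (intro exI[of _ "{I}"]) auto
  next
    case split
    \<comment> \<open>The colon ideals of \<open>I\<close> by powers of \<open>b\<close> increase;
      \<open>k\<close> is an index at which they have become stable.\<close>
    define C where "C k = {c. b ^ k * c \<in> I}" for k
    have "range C \<noteq> {}" by simp
    moreover have "ideal.subspace J" if "J \<in> range C" for J
      using that ideal_colon[OF I] unfolding C_def by auto
    ultimately have "\<exists>J\<in>range C. \<forall>J'\<in>range C. J \<subseteq> J' \<longrightarrow> J' = J"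
      by (rule noetherian_maximal[OF wf])
    then obtain k where k: "\<And>n. C k \<subseteq> C n \<Longrightarrow> C n = C k" by auto
    have "C k \<subseteq> C (Suc k)"
      using ideal.subspace_scale[OF I, of _ b] unfolding C_def by (auto simp: mult.assoc)
    with k have stable: "C (Suc k) = C k" by blast
    let ?A = "{i + c * a | i c. i \<in> I}" and ?B = "{i + c * b ^ k | i c. i \<in> I}"
    have "b ^ k \<notin> I" using split(4) unfolding radical_def by blast
    then have "(?A, I) \<in> ideal_supset" "(?B, I) \<in> ideal_supset"
      using ideal_add_principal[OF I, of a] ideal_add_principal[OF I, of "b ^ k"] I split(3)
      unfolding ideal_supset_def by blast+
    then obtain D E where DE: "finite D" "\<forall>Q\<in>D. primary_ideal Q" "\<Inter>D = ?A"
        "finite E" "\<forall>Q\<in>E. primary_ideal Q" "\<Inter>E = ?B"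
      using "1.IH"[of ?A] "1.IH"[of ?B] unfolding ideal_supset_def by blast
    \<comment> \<open>The first form of \<open>x\<close> puts \<open>b * x\<close> into
      \<open>I\<close>, the second then puts \<open>b ^ Suc k * d\<close> into \<open>I\<close>;
      stability removes the extra factor \<open>b\<close>.\<close>
    have "x \<in> I" if AB: "x \<in> ?A" "x \<in> ?B" for x
    proof -
      obtain i c j d where x: "x = i + c * a" "x = j + d * b ^ k" "i \<in> I" "j \<in> I"
        using AB by blast
      have "b * x = b * i + c * (a * b)" using x(1) by (simp add: algebra_simps)
      then have "b * x \<in> I"
        using x(3) split(2) ideal.subspace_add[OF I] ideal.subspace_scale[OF I] by metis
      moreover have "b ^ Suc k * d = b * x - b * j" using x(2) by (simp add: algebra_simps)
      ultimately have "b ^ Suc k * d \<in> I"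
        using x(4) ideal.subspace_diff[OF I] ideal.subspace_scale[OF I] by metis
      then have "b ^ k * d \<in> I" using stable unfolding C_def by blast
      then show "x \<in> I" using x(2,4) ideal.subspace_add[OF I] by (simp add: mult.commute)
    qed
    then have "?A \<inter> ?B = I"
      using ideal_add_principal(2)[OF I, of a] ideal_add_principal(2)[OF I, of "b ^ k"] by blast
    then have "\<Inter>(D \<union> E) = I" using DE(3,6) by (simp only: Inter_Un_distrib)
    then show ?thesis using DE by (intro exI[of _ "D \<union> E"]) auto
  qed
qed

text \<open>Equal radicals provide a common exponent for both ideals. This allows components with
  the same radical to be merged.\<close>

lemma primary_ideal_Int:
  assumes "primary_ideal Q" "primary_ideal R" "radical Q = radical R"
  shows "primary_ideal (Q \<inter> (R :: 'a::comm_ring_1 set))"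
proof -
  have Q: "ideal.subspace Q" and R: "ideal.subspace R"
    using assms unfolding primary_ideal_def by auto
  have "radical Q \<subseteq> radical (Q \<inter> R)"
  proof
    fix a assume "a \<in> radical Q"
    then obtain k n where "a ^ k \<in> Q" "a ^ n \<in> R"
      using assms(3) unfolding radical_def by blast
    then have "a ^ (k + n) \<in> Q \<inter> R"
      using ideal_power_mono[OF Q] ideal_power_mono[OF R] by auto
    then show "a \<in> radical (Q \<inter> R)" unfolding radical_def by blast
  qed
  with assms show ?thesis
    using ideal.subspace_inter[OF Q R] unfolding primary_ideal_def by blast
qed

text \<open>A decomposition with the fewest members is minimal: two members with equal radical could
  be merged, and a redundant one dropped.\<close>

lemma minimal_primary_decomposition_exists:
  assumes wf: "wf (ideal_supset :: ('a::comm_ring_1 set \<times> 'a set) set)"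
    and "ideal.subspace (I :: 'a set)"
  obtains D where "minimal_primary_decomposition I D"
proof -
  let ?P = "\<lambda>D. finite D \<and> (\<forall>Q\<in>D. primary_ideal Q) \<and> \<Inter>D = I"
  obtain D0 where "?P D0" using primary_decomposition_exists[OF assms] by (elim exE)
  then have "\<exists>D. ?P D \<and> (\<forall>E. ?P E \<longrightarrow> card D \<le> card E)"
    by (rule ex_has_least_nat)
  then obtain D where D: "?P D" and min: "\<And>E. ?P E \<Longrightarrow> card D \<le> card E"
    by metis
  have "inj_on radical D"
  proof (rule inj_onI, rule ccontr)
    fix Q R assume QR: "Q \<in> D" "R \<in> D" "radical Q = radical R" "Q \<noteq> R"
    let ?E = "insert (Q \<inter> R) (D - {Q, R})"
    have "primary_ideal (Q \<inter> R)" using QR D primary_ideal_Int by blast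
    moreover have "\<Inter>?E = \<Inter>D" using QR by blast
    ultimately have "?P ?E" using D by auto
    then have "card D \<le> card ?E" by (rule min)
    also have "\<dots> \<le> Suc (card (D - {Q, R}))" by (rule card_insert_le_m1) auto
    also have "card (D - {Q, R}) = card D - 2"
      using QR D by (subst card_Diff_subset) auto
    finally have "card D < 2" by arith
    moreover have "card {Q, R} \<le> card D" using QR D by (intro card_mono) auto
    ultimately show False using QR(4) by simp
  qed
  moreover have "\<Inter>(D - {Q}) \<noteq> I" if "Q \<in> D" for Q
  proof
    assume "\<Inter>(D - {Q}) = I"
    then have "card D \<le> card (D - {Q})" using D by (intro min) auto
    then show False using card_Diff1_less[of D Q] D \<open>Q \<in> D\<close> by simp
  qed
  ultimately have "minimal_primary_decomposition I D"
    using D unfolding minimal_primary_decomposition_def by simp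
  then show thesis by (rule that)
qed

lemma prod_notin_prime:
  assumes "finite A" "1 \<notin> (P :: 'a::comm_ring_1 set)"
    and "\<forall>a b. a * b \<in> P \<longrightarrow> a \<in> P \<or> b \<in> P" "\<And>i. i \<in> A \<Longrightarrow> f i \<notin> P"
  shows "prod f A \<notin> P"
  using assms(1,4) by (induction A) (use assms(2,3) in auto)

lemma prod_in_ideal:
  assumes "ideal.subspace (I :: 'a::comm_ring_1 set)" "finite A" "i \<in> A" "f i \<in> I"
  shows "prod f A \<in> I"
  using assms ideal_mult_right by (simp add: prod.remove)

text \<open>Every other component has a radical not contained in \<open>P\<close>, hence contains an
  element outside \<open>P\<close>. The product of these elements is the multiplier: it lies in all
  other components.\<close>

lemma isolated_primary_component_local:
  assumes "isolated_primary_component I P Q" "1 \<notin> P"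
    and prime: "\<forall>a b. a * b \<in> P \<longrightarrow> a \<in> P \<or> b \<in> P"
  shows "primary_ideal Q" "radical Q = P" "I \<subseteq> Q"
    and "\<exists>s. s \<notin> P \<and> (\<forall>q\<in>Q. s * q \<in> I)"
proof -
  obtain D where "minimal_primary_decomposition I D" "Q \<in> D" "radical Q = P"
      "\<forall>R\<in>D. \<not> radical R \<subset> P"
    using assms(1) unfolding isolated_primary_component_def by (elim exE conjE)
  then have D: "finite D" "\<And>R. R \<in> D \<Longrightarrow> primary_ideal R" "\<Inter>D = I" "inj_on radical D"
      "Q \<in> D" "radical Q = P" "\<And>R. R \<in> D \<Longrightarrow> \<not> radical R \<subset> P"
    unfolding minimal_primary_decomposition_def by simp_all
  show "primary_ideal Q" "radical Q = P" "I \<subseteq> Q" using D by auto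
  have "\<exists>s. s \<notin> P \<and> s \<in> R" if R: "R \<in> D - {Q}" for R
  proof -
    have "radical R \<noteq> P" using R D(4-6) unfolding inj_on_def by auto
    then obtain a k where a: "a \<notin> P" "a ^ k \<in> R"
      using R D(7)[of R] unfolding radical_def by blast
    have "a ^ k \<notin> P" using a(1) assms(2) prime by (induction k) auto
    with a show ?thesis by blast
  qed
  then obtain s where s: "\<And>R. R \<in> D - {Q} \<Longrightarrow> s R \<notin> P \<and> s R \<in> R" by metis
  let ?s = "prod s (D - {Q})"
  have "?s \<notin> P" using s D(1) assms(2) prime by (intro prod_notin_prime) auto
  moreover have "?s * q \<in> I" if "q \<in> Q" for q
  proof -
    have "?s * q \<in> R" if "R \<in> D" for R
    proof (cases "R = Q")
      case True
      then show ?thesis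
        using \<open>q \<in> Q\<close> D(2,5) ideal.subspace_scale unfolding primary_ideal_def by blast
    next
      case False
      then have "?s \<in> R"
        using that D(1,2) s by (intro prod_in_ideal[of _ _ R]) (auto simp: primary_ideal_def)
      then show ?thesis using that D(2) ideal_mult_right unfolding primary_ideal_def by blast
    qed
    then show ?thesis using D(3) by blast
  qed
  ultimately show "\<exists>s. s \<notin> P \<and> (\<forall>q\<in>Q. s * q \<in> I)" by blast
qed

text \<open>Among the colon ideals of \<open>I\<close> by elements outside \<open>P\<close> there is
  a maximal one, given by \<open>s\<close>. Replacing \<open>s\<close> by \<open>s * t\<close>
  cannot enlarge it, so it already contains whatever \<open>t\<close> moves into
  \<open>I\<close>.\<close>

lemma noetherian_common_multiplier:
  assumes "wf (ideal_supset :: ('a::comm_ring_1 set \<times> 'a set) set)"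
    and I: "ideal.subspace (I :: 'a set)" and "1 \<notin> P"
    and prime: "\<forall>a b. a * b \<in> P \<longrightarrow> a \<in> P \<or> b \<in> P"
    and loc: "\<forall>q\<in>K. \<exists>s. s \<notin> P \<and> s * q \<in> I"
  shows "\<exists>s. s \<notin> P \<and> (\<forall>q\<in>K. s * q \<in> I)"
proof -
  let ?S = "(\<lambda>s. {a. s * a \<in> I}) ` (- P)"
  have "?S \<noteq> {}" using assms(3) by blast
  moreover have "ideal.subspace J" if "J \<in> ?S" for J using that ideal_colon[OF I] by auto
  ultimately have "\<exists>J\<in>?S. \<forall>J'\<in>?S. J \<subseteq> J' \<longrightarrow> J' = J"
    by (rule noetherian_maximal[OF assms(1)])
  then obtain J where J: "J \<in> ?S" "\<And>J'. J' \<in> ?S \<Longrightarrow> J \<subseteq> J' \<Longrightarrow> J' = J"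
    by blast
  then obtain s where s: "s \<notin> P" "J = {a. s * a \<in> I}" by blast
  have "s * q \<in> I" if q: "q \<in> K" for q
  proof -
    obtain t where t: "t \<notin> P" "t * q \<in> I" using loc q by blast
    have "s * t \<notin> P" using s(1) t(1) prime by blast
    moreover have "s * t * a \<in> I" if "s * a \<in> I" for a
      using ideal.subspace_scale[OF I that, of t] by (simp add: ac_simps)
    then have "J \<subseteq> {a. s * t * a \<in> I}" using s(2) by blast
    ultimately have "{a. s * t * a \<in> I} = J" using J(2) by blast
    moreover have "s * t * q \<in> I" using ideal.subspace_scale[OF I t(2), of s] by (simp add: ac_simps)
    ultimately show ?thesis using s(2) by blast
  qed
  with s(1) show ?thesis by blast
qed

text \<open>Comparison with an arbitrary minimal decomposition \<open>D\<close>. Some member lies in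
  \<open>P\<close>, since otherwise a product of elements outside \<open>P\<close> would lie in all
  members, hence in \<open>K\<close> and in \<open>P\<close>. That member contains \<open>K\<close>
  thanks to \<open>s\<close>, and its own multiplier \<open>u\<close> gives the reverse
  inclusion.\<close>

lemma isolated_primary_componentI:
  assumes wf: "wf (ideal_supset :: ('a::comm_ring_1 set \<times> 'a set) set)"
    and I: "ideal.subspace (I :: 'a set)" and K: "primary_ideal K" "radical K = P" "I \<subseteq> K"
    and "1 \<notin> P" and prime: "\<forall>a b. a * b \<in> P \<longrightarrow> a \<in> P \<or> b \<in> P"
    and s: "s \<notin> P" "\<And>q. q \<in> K \<Longrightarrow> s * q \<in> I"
  shows "isolated_primary_component I P K"
proof -
  obtain D where D: "minimal_primary_decomposition I D"
    using minimal_primary_decomposition_exists[OF wf I] .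
  then have D': "finite D" "\<And>R. R \<in> D \<Longrightarrow> primary_ideal R" "\<Inter>D = I" "inj_on radical D"
    unfolding minimal_primary_decomposition_def by blast+
  \<comment> \<open>For \<open>q\<close> in \<open>K\<close> the product \<open>q * s\<close> lies
    in \<open>R\<close> while \<open>s\<close> is outside \<open>radical R\<close>, so primariness
    leaves \<open>q\<close> in \<open>R\<close>. Thus no member has a radical strictly below
    \<open>P\<close>.\<close>
  have below: "radical R = P \<and> K \<subseteq> R" if R: "R \<in> D" "radical R \<subseteq> P" for R
  proof -
    have "K \<subseteq> R"
    proof
      fix q assume "q \<in> K"
      then have "q * s \<in> R" using s(2) D'(3) R(1) by (auto simp: mult.commute)
      moreover have "s \<notin> radical R" using s(1) R(2) by blast
      ultimately show "q \<in> R" using D'(2)[OF R(1)] unfolding primary_ideal_def by blast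
    qed
    then show ?thesis using R(2) K(2) unfolding radical_def by blast
  qed
  have "\<exists>R\<in>D. R \<subseteq> P"
  proof (rule ccontr)
    assume "\<not> ?thesis"
    then have "\<forall>R\<in>D. \<exists>a. a \<in> R \<and> a \<notin> P" by blast
    then obtain f where f: "\<And>R. R \<in> D \<Longrightarrow> f R \<in> R \<and> f R \<notin> P" by metis
    have "prod f D \<notin> P" using f D'(1) assms(6) prime by (intro prod_notin_prime) auto
    moreover have "prod f D \<in> R" if "R \<in> D" for R
      using that D'(1,2) f by (intro prod_in_ideal[of _ _ R]) (auto simp: primary_ideal_def)
    then have "prod f D \<in> K" using D'(3) K(3) by blast
    then have "prod f D \<in> radical K" unfolding radical_def by (auto intro!: exI[of _ 1])
    ultimately show False using K(2) by simp
  qed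
  then obtain R where R: "R \<in> D" "R \<subseteq> P" by blast
  have P_power: "a \<in> P" if "a ^ k \<in> P" for a k
    using that assms(6) prime by (induction k) auto
  have "radical R \<subseteq> P" using R(2) P_power unfolding radical_def by blast
  then have R': "radical R = P" "K \<subseteq> R" using below R(1) by auto
  have iso: "\<forall>Q'\<in>D. \<not> radical Q' \<subset> P" using below by blast
  have "isolated_primary_component I P R"
    using D R(1) R'(1) iso unfolding isolated_primary_component_def by blast
  then obtain u where u: "u \<notin> P" "\<forall>q\<in>R. u * q \<in> I"
    using isolated_primary_component_local(4)[OF _ assms(6) prime] by blast
  have "R \<subseteq> K"
  proof
    fix q assume "q \<in> R"
    then have "q * u \<in> K" using u(2) K(3) by (auto simp: mult.commute)
    then show "q \<in> K" using u(1) K(1,2) unfolding primary_ideal_def by blast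
  qed
  with R'(2) \<open>isolated_primary_component I P R\<close> show ?thesis by simp
qed

text \<open>Nakayama's lemma when the powers of \<open>M\<close> are eventually absorbed by \<open>N\<close>: no ideal lies
  maximally between \<open>N\<close> and \<open>M\<close>.\<close>

lemma noetherian_nakayama:
  assumes wf: "wf (ideal_supset :: ('a::comm_ring_1 set \<times> 'a set) set)"
    and M: "ideal.subspace (M :: 'a set)" and N: "ideal.subspace N" "N \<subseteq> M" "M \<subseteq> radical N"
    and square: "\<And>L. ideal.subspace L \<Longrightarrow> N \<subseteq> L \<Longrightarrow> (\<And>a b. a \<in> M \<Longrightarrow> b \<in> M \<Longrightarrow> a * b \<in> L) \<Longrightarrow> M \<subseteq> L"
  shows "N = M"
proof (rule ccontr)
  assume "N \<noteq> M"
  let ?S = "{L. ideal.subspace L \<and> N \<subseteq> L \<and> L \<subset> M}"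
  have "?S \<noteq> {}" using N \<open>N \<noteq> M\<close> by blast
  then have "\<exists>L\<in>?S. \<forall>J\<in>?S. L \<subseteq> J \<longrightarrow> J = L"
    by (rule noetherian_maximal[OF wf]) simp
  then obtain L where L: "ideal.subspace L" "N \<subseteq> L" "L \<subset> M"
      and max_S: "\<forall>J\<in>?S. L \<subseteq> J \<longrightarrow> J = L"
    by blast
  have max: "J = L" if "ideal.subspace J" "L \<subseteq> J" "J \<subset> M" for J
    using max_S L(2) that by simp
  have "a * b \<in> L" if ab: "a \<in> M" "b \<in> M" for a b
  proof (rule ccontr)
    assume notin: "a * b \<notin> L"
    let ?J = "{i + c * (a * b) | i c. i \<in> L}"
    have J: "ideal.subspace ?J" "L \<subseteq> ?J" "a * b \<in> ?J"
      using ideal_add_principal[OF L(1), of "a * b"] by blast+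
    have "i + c * (a * b) \<in> M" if "i \<in> L" for i c
      using that L(3) ab ideal.subspace_add[OF M] ideal.subspace_scale[OF M] by (meson psubsetD)
    then have "?J \<subseteq> M" by blast
    \<comment> \<open>Maximality of \<open>L\<close> makes \<open>b\<close> itself a multiple of
      \<open>a * b\<close> modulo \<open>L\<close>.\<close>
    then have "?J = M" using max[OF J(1,2)] J(3) notin by blast
    with ab(2) obtain i c where b: "b = i + c * (a * b)" "i \<in> L" by blast
    obtain k where k: "a ^ k \<in> N" using N(3) ab(1) unfolding radical_def by blast
    \<comment> \<open>\<open>b\<close> is congruent to \<open>(c a)\<^sup>n b\<close> modulo \<open>L\<close>, and \<open>a\<close> is nilpotent there\<close>
    have "b - (c * a) ^ n * b \<in> L" for n
    proof (induction n)
      case 0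
      then show ?case using ideal.subspace_0[OF L(1)] by simp
    next
      case (Suc n)
      have "b - (c * a) ^ Suc n * b = (b - (c * a) ^ n * b) + (c * a) ^ n * (b - c * (a * b))"
        by (simp add: algebra_simps)
      also have "b - c * (a * b) = i" using b(1) by (metis add_diff_cancel_right')
      finally have "b - (c * a) ^ Suc n * b = (b - (c * a) ^ n * b) + (c * a) ^ n * i" .
      then show ?case
        using Suc ideal.subspace_add[OF L(1)] ideal.subspace_scale[OF L(1) b(2)] by metis
    qed
    from this[of k] have "b - a ^ k * (c ^ k * b) \<in> L"
      by (simp add: power_mult_distrib ac_simps)
    moreover have "a ^ k * (c ^ k * b) \<in> L" using k L(2) ideal_mult_right[OF L(1)] by blast
    ultimately have "b \<in> L" using ideal.subspace_add[OF L(1)] by fastforce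
    then show False using notin ideal.subspace_scale[OF L(1)] by blast
  qed
  then show False using square[OF L(1,2)] L(3) by blast
qed


section \<open>Hilbert's basis theorem\<close>

text \<open>A monotone subsequence exists; if it is decreasing, it is eventually constant, and its
  tail serves instead.\<close>

lemma nat_seq_mono_subseq:
  fixes f :: "nat \<Rightarrow> nat"
  obtains r :: "nat \<Rightarrow> nat" where "strict_mono r" "mono (\<lambda>n. f (r n))"
proof -
  obtain r :: "nat \<Rightarrow> nat" where r: "strict_mono r" "monoseq (\<lambda>n. f (r n))"
    using seq_monosub by blast
  show thesis
  proof (cases "mono (\<lambda>n. f (r n))")
    case True
    then show ?thesis using r(1) that by blast
  next
    case False
    then have dec: "f (r n) \<le> f (r m)" if "m \<le> n" for m n
      using r(2) that unfolding monoseq_def mono_def by auto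
    obtain k where k: "\<And>n. f (r k) \<le> f (r n)"
      using ex_has_least_nat[of "\<lambda>_. True" _ "\<lambda>n. f (r n)"] by auto
    have "f (r (k + n)) = f (r k)" for n
      using k[of "k + n"] dec[of k "k + n"] by simp
    then have "mono (\<lambda>n. f (r (k + n)))" by (simp add: mono_def)
    moreover have "strict_mono (\<lambda>n. r (k + n))"
      using r(1) by (simp add: strict_mono_def)
    ultimately show ?thesis using that by blast
  qed
qed

text \<open>Subsequences are extracted for one coordinate after another until all coordinates
  increase weakly; then any two terms are comparable.\<close>

lemma dickson:
  fixes f :: "nat \<Rightarrow> 'v::finite \<Rightarrow> nat"
  obtains i j where "i < j" "f i \<le> f j"
proof -
  have "\<exists>r :: nat \<Rightarrow> nat. strict_mono r \<and> (\<forall>v\<in>V. mono (\<lambda>n. f (r n) v))" if "finite V" for V :: "'v set"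
    using that
  proof induction
    case empty
    show ?case by (rule exI[of _ "\<lambda>n. n"]) (simp add: strict_mono_def)
  next
    case (insert v V)
    then obtain r :: "nat \<Rightarrow> nat" where r: "strict_mono r" "\<And>w. w \<in> V \<Longrightarrow> mono (\<lambda>n. f (r n) w)" by blast
    obtain q :: "nat \<Rightarrow> nat" where q: "strict_mono q" "mono (\<lambda>n. f (r (q n)) v)"
      by (rule nat_seq_mono_subseq[of "\<lambda>n. f (r n) v"])
    have "strict_mono (r \<circ> q)" using r(1) q(1) by (rule strict_mono_o)
    moreover have "mono (\<lambda>n. f (r (q n)) w)" if "w \<in> V" for w
      using r(2)[OF that] strict_mono_mono[OF q(1)] by (simp add: mono_def)
    ultimately show ?case
      using q(2) by (intro exI[of _ "r \<circ> q"]) (auto simp: comp_def)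
  qed
  from this[of UNIV] obtain r :: "nat \<Rightarrow> nat" where r: "strict_mono r" "\<And>v. mono (\<lambda>n. f (r n) v)" by auto
  have "r 0 < r 1" using r(1) by (simp add: strict_mono_def)
  moreover have "f (r 0) \<le> f (r 1)" using r(2) by (auto simp: le_fun_def mono_def)
  ultimately show thesis using that by blast
qed

text \<open>A copy of the exponent vector indexed by natural numbers, to borrow the lexicographic order
  of \<^typ>\<open>nat \<Rightarrow>\<^sub>0 nat\<close>: a finite type \<open>'v\<close> comes without a linear order.\<close>

definition lex_key :: "('v::finite \<Rightarrow>\<^sub>0 nat) \<Rightarrow> (nat \<Rightarrow>\<^sub>0 nat)"
  where "lex_key m = (\<Sum>v\<in>UNIV.
    Poly_Mapping.single (to_nat_on (UNIV :: 'v set) v) (Poly_Mapping.lookup m v))"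

lemma lex_key_add: "lex_key (m + n) = lex_key m + lex_key n"
  unfolding lex_key_def by (simp add: lookup_add single_add sum.distrib)

lemma lookup_lex_key:
  "Poly_Mapping.lookup (lex_key m) (to_nat_on UNIV v) = Poly_Mapping.lookup m (v :: 'v::finite)"
proof -
  have inj: "inj (to_nat_on (UNIV :: 'v set))"
    by (rule inj_on_to_nat_on) simp
  have "Poly_Mapping.lookup (lex_key m) (to_nat_on UNIV v) =
      (\<Sum>w\<in>UNIV. if w = v then Poly_Mapping.lookup m w else 0)"
    unfolding lex_key_def lookup_sum
    by (intro sum.cong) (auto simp: lookup_single when_def injD[OF inj])
  then show ?thesis by simp
qed

lemma inj_lex_key: "inj lex_key"
  by (rule injI, rule poly_mapping_eqI) (metis lookup_lex_key)

text \<open>The quotient monomial has a key above 0: a smaller key would have a negative exponent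
  where it first differs from 0.\<close>

lemma lex_key_mono:
  assumes "Poly_Mapping.lookup m \<le> Poly_Mapping.lookup n"
  shows "lex_key m \<le> lex_key n"
proof -
  have "n = m + (n - m)"
    using assms by (intro poly_mapping_eqI) (simp add: lookup_add lookup_minus le_fun_def)
  then have eq: "lex_key n = lex_key m + lex_key (n - m)" by (metis lex_key_add)
  have "0 \<le> x" for x :: "nat \<Rightarrow>\<^sub>0 nat"
  proof (rule leI, rule notI)
    assume "x < 0"
    then show False by (simp add: less_poly_mapping.rep_eq less_fun_def)
  qed
  with eq show ?thesis by (metis add.right_neutral add_left_mono)
qed

text \<open>The lexicographic order on all of \<open>nat \<Rightarrow>\<^sub>0 nat\<close> is not
  well-founded; finiteness of \<open>'v\<close> enters through Dickson's lemma, which finds a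
  divisibility inside any descending chain.\<close>

lemma wf_lex_key: "wf {(m :: 'v::finite \<Rightarrow>\<^sub>0 nat, n). lex_key m < lex_key n}"
  unfolding wf_iff_no_infinite_down_chain
proof
  assume "\<exists>f. \<forall>i. (f (Suc i), f i) \<in> {(m :: 'v \<Rightarrow>\<^sub>0 nat, n). lex_key m < lex_key n}"
  then obtain f :: "nat \<Rightarrow> ('v \<Rightarrow>\<^sub>0 nat)" where f: "\<And>i. lex_key (f (Suc i)) < lex_key (f i)"
    by auto
  obtain i j where ij: "i < j" "Poly_Mapping.lookup (f i) \<le> Poly_Mapping.lookup (f j)"
    using dickson[of "\<lambda>i. Poly_Mapping.lookup (f i)"] .
  have "lex_key (f j) < lex_key (f i)"
    using ij(1) by (induction rule: less_Suc_induct) (auto intro: f less_trans)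
  with lex_key_mono[OF ij(2)] show False by simp
qed

definition lead_mono :: "('v::finite \<Rightarrow>\<^sub>0 nat) \<Rightarrow> 'v cpoly \<Rightarrow> bool"
  where "lead_mono m p \<longleftrightarrow> m \<in> Poly_Mapping.keys p \<and>
    (\<forall>k\<in>Poly_Mapping.keys p. lex_key k \<le> lex_key m)"

lemma lead_mono_exists:
  assumes "p \<noteq> 0"
  obtains m where "lead_mono m p"
proof -
  have "finite (lex_key ` Poly_Mapping.keys p)" "lex_key ` Poly_Mapping.keys p \<noteq> {}"
    using assms by auto
  from Max_in[OF this] Max_ge[OF this(1)] show thesis
    using that unfolding lead_mono_def by force
qed

lemma keys_single_mult:
  "Poly_Mapping.keys (Poly_Mapping.single d c * p) \<subseteq> (\<lambda>k. d + k) ` Poly_Mapping.keys (p :: 'v cpoly)"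
  using keys_mult[of "Poly_Mapping.single d c" p] by (auto split: if_splits)

lemma lookup_single_mult:
  "Poly_Mapping.lookup (Poly_Mapping.single d c * p) (d + k) = c * Poly_Mapping.lookup (p :: 'v cpoly) k"
proof -
  have "Poly_Mapping.lookup (Poly_Mapping.single d c * p) (d + k) =
      c * (\<Sum>q. Poly_Mapping.lookup p q when d + k = d + q)"
    unfolding lookup_mult by (simp add: lookup_single when_mult)
  then show ?thesis by simp
qed

text \<open>In a strictly increasing chain choose elements outside the preceding ideal with lexicographically
  least leading monomial. By Dickson's lemma one of these monomials divides a later one, which
  contradicts minimality after one step of division.\<close>

theorem wf_cpoly_ideals: "wf (ideal_supset :: ('v::finite cpoly set \<times> 'v cpoly set) set)"
  unfolding wf_iff_no_infinite_down_chain
proof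
  assume "\<exists>f. \<forall>i. (f (Suc i), f i) \<in> (ideal_supset :: ('v cpoly set \<times> 'v cpoly set) set)"
  then obtain I :: "nat \<Rightarrow> 'v cpoly set"
    where I: "\<And>i. ideal.subspace (I i)" "\<And>i. I i \<subset> I (Suc i)"
    unfolding ideal_supset_def mem_Collect_eq prod.case by metis
  have I_mono: "I i \<subseteq> I j" if "i \<le> j" for i j
    using lift_Suc_mono_le[of I, OF _ that] I(2) by blast
  define S where "S i = {m. \<exists>p\<in>I (Suc i) - I i. lead_mono m p}" for i
  have "\<exists>m\<in>S i. \<forall>n. lex_key n < lex_key m \<longrightarrow> n \<notin> S i" for i
  proof -
    obtain p where p: "p \<in> I (Suc i)" "p \<notin> I i" using I(2)[of i] by blast
    then have "p \<noteq> 0" using ideal.subspace_0[OF I(1)] by blast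
    then obtain m where "lead_mono m p" using lead_mono_exists by blast
    then have "m \<in> S i" using p unfolding S_def by blast
    from wfE_min[OF wf_lex_key this] show ?thesis
      by (metis (mono_tags, lifting) case_prodI mem_Collect_eq)
  qed
  then obtain m where m: "\<And>i. m i \<in> S i" "\<And>i n. lex_key n < lex_key (m i) \<Longrightarrow> n \<notin> S i"
    by metis
  have "\<exists>p. p \<in> I (Suc i) \<and> p \<notin> I i \<and> lead_mono (m i) p" for i
    using m(1)[of i] unfolding S_def by blast
  then obtain p where p: "\<And>i. p i \<in> I (Suc i)" "\<And>i. p i \<notin> I i" "\<And>i. lead_mono (m i) (p i)"
    by metis
  obtain i j where ij: "i < j" "Poly_Mapping.lookup (m i) \<le> Poly_Mapping.lookup (m j)"
    using dickson[of "\<lambda>i. Poly_Mapping.lookup (m i)"] .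
  define d where "d = m j - m i"
  have d: "d + m i = m j"
    using ij(2) unfolding d_def by (intro poly_mapping_eqI) (simp add: lookup_add lookup_minus le_fun_def)
  \<comment> \<open>This factor cancels the leading term of \<open>p j\<close>. Subtracting
    \<open>g\<close>, which lies in \<open>I j\<close>, keeps the difference outside
    \<open>I j\<close>, so it competes with \<open>p j\<close> for the least leading
    monomial.\<close>
  define c where "c = Poly_Mapping.lookup (p j) (m j) / Poly_Mapping.lookup (p i) (m i)"
  define g where "g = Poly_Mapping.single d c * p i"
  have "p i \<in> I j" using p(1)[of i] I_mono[of "Suc i" j] ij(1) by auto
  then have g: "g \<in> I j" unfolding g_def by (rule ideal.subspace_scale[OF I(1)])
  have r: "p j - g \<in> I (Suc j)" "p j - g \<notin> I j"
  proof -
    show "p j - g \<in> I (Suc j)" using p(1) g I(2)[of j] ideal.subspace_diff[OF I(1)] by blast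
    show "p j - g \<notin> I j" using p(2)[of j] g ideal.subspace_add[OF I(1), of "p j - g" j g] by auto
  qed
  then have "p j - g \<noteq> 0" using ideal.subspace_0[OF I(1)] by metis
  then obtain n where n: "lead_mono n (p j - g)" using lead_mono_exists by blast
  then have "n \<in> S j" using r unfolding S_def by blast
  have pi: "Poly_Mapping.lookup (p i) (m i) \<noteq> 0"
    using p(3)[of i] unfolding lead_mono_def by (simp add: in_keys_iff)
  have "Poly_Mapping.lookup g (m j) = Poly_Mapping.lookup (p j) (m j)"
    using lookup_single_mult[of d c "p i" "m i"] pi unfolding g_def c_def d by simp
  then have "n \<noteq> m j" using n unfolding lead_mono_def by (auto simp: in_keys_iff lookup_minus)
  moreover have "lex_key n \<le> lex_key (m j)"
  proof -
    have "n \<in> Poly_Mapping.keys (p j) \<union> Poly_Mapping.keys g"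
      using n keys_diff[of "p j" g] unfolding lead_mono_def by blast
    then show ?thesis
    proof
      assume "n \<in> Poly_Mapping.keys (p j)"
      then show ?thesis using p(3)[of j] unfolding lead_mono_def by blast
    next
      assume "n \<in> Poly_Mapping.keys g"
      then obtain k where k: "n = d + k" "k \<in> Poly_Mapping.keys (p i)"
        using keys_single_mult[of d c "p i"] unfolding g_def by blast
      then have "lex_key k \<le> lex_key (m i)" using p(3)[of i] unfolding lead_mono_def by blast
      then show ?thesis unfolding k(1) d[symmetric] lex_key_add by (rule add_left_mono)
    qed
  qed
  ultimately have "lex_key n < lex_key (m j)" 
    by (simp add: order.strict_iff_order inj_eq[OF inj_lex_key])
  with m(2) \<open>n \<in> S j\<close> show False by blast
qed


section \<open>Substitution homomorphisms and derivations\<close>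

locale cring_hom =
  fixes \<phi> :: "'a::comm_ring_1 \<Rightarrow> 'b::comm_ring_1"
  assumes hom_add: "\<phi> (a + b) = \<phi> a + \<phi> b"
    and hom_mult: "\<phi> (a * b) = \<phi> a * \<phi> b"
    and hom_one: "\<phi> 1 = 1"
begin

lemma hom_zero: "\<phi> 0 = 0"
  using hom_add[of 0 0] by simp

lemma hom_diff: "\<phi> (a - b) = \<phi> a - \<phi> b"
  using hom_add[of "a - b" b] by (simp add: algebra_simps)

lemma hom_sum: "\<phi> (sum f A) = (\<Sum>a\<in>A. \<phi> (f a))"
  by (induction A rule: infinite_finite_induct) (simp_all add: hom_zero hom_add)

lemma hom_power: "\<phi> (a ^ n) = \<phi> a ^ n"
  by (induction n) (simp_all add: hom_one hom_mult)

lemmas hom_simps = hom_add hom_mult hom_one hom_zero hom_diff hom_sum hom_power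

lemma ideal_vimage:
  assumes "ideal.subspace J"
  shows "ideal.subspace {a. \<phi> a \<in> J}"
  using assms unfolding ideal.subspace_def by (simp add: hom_simps)

lemma span_into_ideal:
  assumes "a \<in> ideal.span S" "ideal.subspace J" "\<And>s. s \<in> S \<Longrightarrow> \<phi> s \<in> J"
  shows "\<phi> a \<in> J"
  using ideal.span_minimal[OF _ ideal_vimage[OF assms(2)], of S] assms(1,3) by blast

end

lemma cring_hom_comp: "cring_hom \<phi> \<Longrightarrow> cring_hom \<psi> \<Longrightarrow> cring_hom (\<lambda>a. \<psi> (\<phi> a))"
  unfolding cring_hom_def by simp

lemma cring_hom_id: "cring_hom (\<lambda>a. a)"
  by standard simp_all

lemma Const_hom: "cring_hom Const"
  by standard (simp_all add: Const_def single_add mult_single)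

lemma pconst_hom: "cring_hom (\<lambda>c :: 'a::comm_ring_1. [:c:])"
  by standard (simp_all add: one_pCons)

lemmas Const_simps = cring_hom.hom_simps[OF Const_hom]

text \<open>Constants and variables generate the ring. Monomials lose one variable at a time,
  polynomials one term at a time.\<close>

lemma cpoly_induct [case_names Const Var add mult]:
  fixes p :: "'v::finite cpoly"
  assumes "\<And>c. P (Const c)" "\<And>v. P (Var v)"
    and add: "\<And>p q. P p \<Longrightarrow> P q \<Longrightarrow> P (p + q)" and mult: "\<And>p q. P p \<Longrightarrow> P q \<Longrightarrow> P (p * q)"
  shows "P p"
proof -
  have mono: "P (Poly_Mapping.single m 1)" for m :: "'v \<Rightarrow>\<^sub>0 nat"
  proof (induction "\<Sum>v\<in>UNIV. Poly_Mapping.lookup m v" arbitrary: m)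
    case 0
    then have "m = 0" by (intro poly_mapping_eqI) simp
    then show ?case using assms(1)[of 1] by (simp add: Const_def)
  next
    case (Suc n)
    then obtain v where v: "Poly_Mapping.lookup m v \<noteq> 0"
      by (metis nat.distinct(1) sum.neutral)
    define k where "k = m - Poly_Mapping.single v 1"
    have m: "m = k + Poly_Mapping.single v 1"
      using v unfolding k_def
      by (intro poly_mapping_eqI) (auto simp: lookup_add lookup_minus lookup_single when_def)
    have "n = (\<Sum>v\<in>UNIV. Poly_Mapping.lookup k v)"
      using Suc(2) unfolding m by (simp add: lookup_add sum.distrib lookup_single when_def)
    then have "P (Poly_Mapping.single k 1)" using Suc(1) by blast
    then have "P (Poly_Mapping.single k 1 * Var v)" using mult assms(2) by blast
    then show ?case by (simp add: Var_def mult_single m)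
  qed
  show ?thesis
  proof (induction p rule: update_induct)
    case const
    then show ?case using assms(1)[of 0] by (simp add: Const_def)
  next
    case (update p m c)
    have "Poly_Mapping.update m c p = p + Const c * Poly_Mapping.single m 1"
      using update(1)
      by (intro poly_mapping_eqI)
        (auto simp: lookup_update lookup_add Const_def mult_single lookup_single when_def in_keys_iff)
    then show ?case using add mult mono assms(1) update by metis
  qed
qed

text \<open>Cancellation may shrink the support of a sum; a common index set makes the sums for both
  summands and their sum comparable.\<close>

lemma sum_keys_mono:
  assumes "finite A" "Poly_Mapping.keys p \<subseteq> A" "\<And>m. g m 0 = (0 :: 'b::comm_monoid_add)"
  shows "(\<Sum>m\<in>Poly_Mapping.keys p. g m (Poly_Mapping.lookup p m)) =
    (\<Sum>m\<in>A. g m (Poly_Mapping.lookup p m))"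
  using assms by (intro sum.mono_neutral_left) (auto simp: in_keys_iff)

lemma sum_keys_add:
  assumes "\<And>m. g m 0 = (0 :: 'b::comm_monoid_add)" "\<And>m a b. g m (a + b) = g m a + g m b"
  shows "(\<Sum>m\<in>Poly_Mapping.keys (p + q). g m (Poly_Mapping.lookup (p + q) m)) =
    (\<Sum>m\<in>Poly_Mapping.keys p. g m (Poly_Mapping.lookup p m)) +
    (\<Sum>m\<in>Poly_Mapping.keys q. g m (Poly_Mapping.lookup q m))"
proof -
  let ?A = "Poly_Mapping.keys p \<union> Poly_Mapping.keys q"
  note eq = sum_keys_mono[of ?A _ g, OF _ _ assms(1)]
  show ?thesis
    using eq[of p] eq[of q] eq[of "p + q"] keys_add[of p q]
    by (simp add: lookup_add assms(2) sum.distrib)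
qed

lemma sum_keys_single:
  assumes "\<And>m. g m 0 = (0 :: 'b::comm_monoid_add)"
  shows "(\<Sum>m\<in>Poly_Mapping.keys (Poly_Mapping.single k c). 
      g m (Poly_Mapping.lookup (Poly_Mapping.single k c) m)) = g k c"
  using assms by simp

text \<open>Biadditive maps are determined by their values on single terms. Multiplicativity of
  substitution and the Leibniz rule are both checked this way.\<close>

lemma additive_mult_induct:
  fixes L R :: "'v::finite cpoly \<Rightarrow> 'v cpoly \<Rightarrow> 'b::cancel_comm_monoid_add"
  assumes "\<And>p p' q. L (p + p') q = L p q + L p' q" "\<And>p q q'. L p (q + q') = L p q + L p q'"
    and "\<And>p p' q. R (p + p') q = R p q + R p' q" "\<And>p q q'. R p (q + q') = R p q + R p q'"
    and single: "\<And>k l a b. L (Poly_Mapping.single k a) (Poly_Mapping.single l b) =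
      R (Poly_Mapping.single k a) (Poly_Mapping.single l b)"
  shows "L p q = R p q"
proof -
  have zero: "L 0 q = 0" "R 0 q = 0" "L p 0 = 0" "R p 0 = 0" for p q
    using assms(1,3)[of 0 0 q] assms(2,4)[of p 0 0] by simp_all
  have upd: "Poly_Mapping.update m c p = p + Poly_Mapping.single m c"
    if "m \<notin> Poly_Mapping.keys p" for m c and p :: "'v cpoly"
    using that by (intro poly_mapping_eqI)
      (auto simp: lookup_update lookup_add lookup_single when_def in_keys_iff)
  have "L p (Poly_Mapping.single l b) = R p (Poly_Mapping.single l b)" for p l b
  proof (induction p rule: update_induct)
    case const
    show ?case by (simp add: zero)
  next
    case (update p m c)
    then show ?case by (simp add: upd assms)
  qed
  then show ?thesis
  proof (induction q rule: update_induct)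
    case const
    show ?case by (simp add: zero)
  next
    case (update q m c)
    then show ?case by (simp add: upd assms)
  qed
qed

lemma cpoly_subst_hom:
  fixes f :: "'v::finite \<Rightarrow> 'r::comm_ring_1"
  assumes "cring_hom \<phi>"
  shows "cring_hom (cpoly_subst \<phi> f)"
proof
  interpret cring_hom \<phi> by fact
  let ?g = "\<lambda>m c. \<phi> c * (\<Prod>v\<in>UNIV. f v ^ Poly_Mapping.lookup m v)"
  have g: "\<And>m. ?g m 0 = 0" "\<And>m a b. ?g m (a + b) = ?g m a + ?g m b"
    by (simp_all add: hom_simps distrib_right)
  show add: "cpoly_subst \<phi> f (p + q) = cpoly_subst \<phi> f p + cpoly_subst \<phi> f q" for p q
    unfolding cpoly_subst_def using g by (rule sum_keys_add)
  have single: "cpoly_subst \<phi> f (Poly_Mapping.single k c) = ?g k c" for k c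
    unfolding cpoly_subst_def using g(1) by (rule sum_keys_single)
  show "cpoly_subst \<phi> f 1 = 1"
    using single[of 0 1] by (simp add: hom_simps)
  show "cpoly_subst \<phi> f (p * q) = cpoly_subst \<phi> f p * cpoly_subst \<phi> f q" for p q
    by (rule additive_mult_induct)
      (simp_all add: distrib_left distrib_right add single mult_single hom_simps lookup_add
        power_add prod.distrib ac_simps)
qed

lemma cpoly_subst_Const:
  assumes "cring_hom \<phi>"
  shows "cpoly_subst \<phi> f (Const c) = \<phi> c"
  using cring_hom.hom_zero[OF assms] unfolding cpoly_subst_def Const_def by simp

lemma cpoly_subst_Var:
  assumes "cring_hom \<phi>"
  shows "cpoly_subst \<phi> f (Var v) = f v"
proof -
  have "(\<Prod>w\<in>UNIV. f w ^ Poly_Mapping.lookup (Poly_Mapping.single v 1) w) =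
      (\<Prod>w\<in>UNIV. if w = v then f w else 1)"
    by (intro prod.cong) (auto simp: lookup_single when_def)
  then show ?thesis
    using cring_hom.hom_one[OF assms] unfolding cpoly_subst_def Var_def by simp
qed

lemma cpoly_hom_eqI:
  assumes "cring_hom \<phi>" "cring_hom \<psi>"
    and "\<And>c. \<phi> (Const c) = \<psi> (Const c)" "\<And>v. \<phi> (Var v) = \<psi> (Var v)"
  shows "\<phi> p = \<psi> (p :: 'v::finite cpoly)"
  by (induction p rule: cpoly_induct)
    (simp_all add: assms cring_hom.hom_simps[OF assms(1)] cring_hom.hom_simps[OF assms(2)])

lemma cpoly_eval_hom: "cring_hom (cpoly_eval x)"
  unfolding cpoly_eval_def by (rule cpoly_subst_hom[OF cring_hom_id])

lemma cpoly_eval_Const: "cpoly_eval x (Const c) = c"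
  unfolding cpoly_eval_def by (rule cpoly_subst_Const[OF cring_hom_id])

lemma cpoly_eval_Var: "cpoly_eval x (Var v) = x $ v"
  unfolding cpoly_eval_def by (rule cpoly_subst_Var[OF cring_hom_id])

lemmas eval_simps = cring_hom.hom_simps[OF cpoly_eval_hom] cpoly_eval_Const cpoly_eval_Var

lemma in_x_hom: "cring_hom in_x"
proof -
  have "in_x = cpoly_subst Const (\<lambda>j. Var (Inl j))" unfolding in_x_def by auto
  then show ?thesis using cpoly_subst_hom[OF Const_hom] by metis
qed

lemma in_x_Const: "in_x (Const c) = Const c"
  unfolding in_x_def by (rule cpoly_subst_Const[OF Const_hom])

lemma in_x_Var: "in_x (Var v) = Var (Inl v)"
  unfolding in_x_def by (rule cpoly_subst_Var[OF Const_hom])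

lemmas in_x_simps = cring_hom.hom_simps[OF in_x_hom] in_x_Const in_x_Var

lemma cpoly_deriv_add: "cpoly_deriv v (p + q) = cpoly_deriv v p + cpoly_deriv v q"
  unfolding cpoly_deriv_def
  by (rule sum_keys_add[of "\<lambda>m c. Poly_Mapping.single (m - Poly_Mapping.single v 1)
        (of_nat (Poly_Mapping.lookup m v) * c)"]) (simp_all add: distrib_left single_add)

lemma cpoly_deriv_single:
  "cpoly_deriv v (Poly_Mapping.single k c) =
    Poly_Mapping.single (k - Poly_Mapping.single v 1) (of_nat (Poly_Mapping.lookup k v) * c)"
  unfolding cpoly_deriv_def
  by (rule sum_keys_single[of "\<lambda>m c. Poly_Mapping.single (m - Poly_Mapping.single v 1)
        (of_nat (Poly_Mapping.lookup m v) * c)"]) simp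

lemma cpoly_deriv_mult:
  "cpoly_deriv v (p * q) = p * cpoly_deriv v q + q * cpoly_deriv v (p :: 'v::finite cpoly)"
proof (rule additive_mult_induct[where L = "\<lambda>p q. cpoly_deriv v (p * q)"
      and R = "\<lambda>p q. p * cpoly_deriv v q + q * cpoly_deriv v p"])
  fix k l :: "'v \<Rightarrow>\<^sub>0 nat" and a b :: complex
  let ?s = "Poly_Mapping.single v (1 :: nat)"
  \<comment> \<open>If \<open>v\<close> does not occur in \<open>l\<close>, truncated subtraction
    may give different exponents on the two sides, but then the coefficient is 0.\<close>
  have shift: "Poly_Mapping.single (k + l - ?s) (of_nat (Poly_Mapping.lookup l v) * c) =
      Poly_Mapping.single (k + (l - ?s)) (of_nat (Poly_Mapping.lookup l v) * c)"
    for k l :: "'v \<Rightarrow>\<^sub>0 nat" and c :: complex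
  proof (cases "Poly_Mapping.lookup l v = 0")
    case False
    then have "k + l - ?s = k + (l - ?s)"
      by (intro poly_mapping_eqI) (auto simp: lookup_add lookup_minus lookup_single when_def)
    then show ?thesis by simp
  qed simp
  have "cpoly_deriv v (Poly_Mapping.single k a * Poly_Mapping.single l b) =
      Poly_Mapping.single (k + l - ?s) (of_nat (Poly_Mapping.lookup l v) * (a * b)) +
      Poly_Mapping.single (l + k - ?s) (of_nat (Poly_Mapping.lookup k v) * (a * b))"
    by (simp add: mult_single cpoly_deriv_single lookup_add distrib_right add.commute
        flip: single_add)
  also have "\<dots> = Poly_Mapping.single (k + (l - ?s)) (of_nat (Poly_Mapping.lookup l v) * (a * b)) +
      Poly_Mapping.single (l + (k - ?s)) (of_nat (Poly_Mapping.lookup k v) * (a * b))"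
    by (simp only: shift)
  also have "\<dots> = Poly_Mapping.single k a * cpoly_deriv v (Poly_Mapping.single l b) +
      Poly_Mapping.single l b * cpoly_deriv v (Poly_Mapping.single k a)"
    by (simp add: mult_single cpoly_deriv_single mult.assoc mult.left_commute mult.commute)
  finally show "cpoly_deriv v (Poly_Mapping.single k a * Poly_Mapping.single l b) =
      Poly_Mapping.single k a * cpoly_deriv v (Poly_Mapping.single l b) +
      Poly_Mapping.single l b * cpoly_deriv v (Poly_Mapping.single k a)" .
qed (simp_all add: distrib_left distrib_right cpoly_deriv_add ac_simps)

lemma cpoly_deriv_Const: "cpoly_deriv v (Const c) = 0"
  unfolding Const_def by (simp add: cpoly_deriv_single)

lemma cpoly_deriv_Var: "cpoly_deriv v (Var w) = Const (if v = w then 1 else 0)"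
  unfolding Var_def by (simp add: cpoly_deriv_single Const_def lookup_single when_def)

text \<open>A derivation over \<open>\<phi>\<close> is determined by its values on the
  generators.\<close>

lemma derivation_chain_rule:
  fixes \<delta> :: "'v::finite cpoly \<Rightarrow> 'b::comm_ring_1"
  assumes \<phi>: "cring_hom \<phi>"
    and add: "\<And>p q. \<delta> (p + q) = \<delta> p + \<delta> q"
    and mult: "\<And>p q. \<delta> (p * q) = \<phi> p * \<delta> q + \<phi> q * \<delta> p"
    and const: "\<And>c. \<delta> (Const c) = 0"
  shows "\<delta> p = (\<Sum>v\<in>UNIV. \<phi> (cpoly_deriv v p) * \<delta> (Var v))"
proof (induction p rule: cpoly_induct)
  case (Const c)
  then show ?case by (simp add: const cpoly_deriv_Const cring_hom.hom_simps[OF \<phi>])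
next
  case (Var w)
  have "\<phi> (cpoly_deriv v (Var w)) * \<delta> (Var v) = (if v = w then \<delta> (Var w) else 0)" for v
    by (auto simp: cpoly_deriv_Var Const_simps cring_hom.hom_simps[OF \<phi>])
  then show ?case by simp
next
  case (add p q)
  then show ?case
    by (simp add: assms(2) cpoly_deriv_add cring_hom.hom_simps[OF \<phi>] distrib_right sum.distrib)
next
  case (mult p q)
  then show ?case
    by (simp add: assms(3) cpoly_deriv_mult cring_hom.hom_simps[OF \<phi>] distrib_right sum.distrib
        sum_distrib_left mult.assoc)
qed


section \<open>Polynomials in one element\<close>

text \<open>The value of \<open>f\<close> at \<open>l\<close> by Horner's scheme, with
  \<open>Const\<close> carrying the coefficients into the ring of \<open>l\<close>.\<close>

definition pev :: "'v::finite cpoly \<Rightarrow> complex poly \<Rightarrow> 'v cpoly"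
  where "pev l f = fold_coeffs (\<lambda>a q. Const a + l * q) f 0"

lemma pev_0: "pev l 0 = 0"
  by (simp add: pev_def)

lemma pev_pCons: "pev l (pCons a f) = Const a + l * pev l f"
  by (cases "f = 0 \<and> a = 0") (auto simp: pev_def Const_simps)

lemma pev_add: "pev l (f + g) = pev l f + pev l g"
proof (induction f arbitrary: g)
  case (pCons a f)
  obtain b g' where "g = pCons b g'" by (cases g)
  with pCons(2)[of g'] show ?case by (simp add: pev_pCons Const_simps distrib_left)
qed (simp add: pev_0)

lemma pev_smult: "pev l (smult c f) = Const c * pev l f"
  by (induction f) (simp_all add: pev_0 pev_pCons Const_simps algebra_simps)

lemma pev_hom: "cring_hom (pev l)"
proof
  show "pev l (f + g) = pev l f + pev l g" for f g by (rule pev_add)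
  show "pev l (f * g) = pev l f * pev l g" for f g
    by (induction f) (simp_all add: pev_0 pev_pCons pev_add pev_smult Const_simps algebra_simps)
  show "pev l 1 = 1" by (simp add: one_pCons pev_pCons pev_0 Const_simps)
qed

lemmas pev_simps = cring_hom.hom_simps[OF pev_hom]

lemma pev_const: "pev l [:c:] = Const c"
  by (simp add: pev_pCons pev_0)

lemma pev_linear: "pev l [:0, 1:] = l"
  by (simp add: pev_pCons pev_0 Const_simps)

lemma pev_monom: "pev l (monom c n) = Const c * l ^ n"
  by (induction n) (simp_all add: monom_0 monom_Suc pev_0 pev_const pev_pCons Const_simps ac_simps)

lemma eval_pev: "cpoly_eval x (pev l f) = poly f (cpoly_eval x l)"
  by (induction f) (simp_all add: pev_0 pev_pCons eval_simps)

lemma in_x_pev: "in_x (pev l f) = pev (in_x l) f"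
  by (induction f) (simp_all add: pev_0 pev_pCons in_x_simps)

lemma subst_pconst_hom: "cring_hom (cpoly_subst (\<lambda>c. [:c:]) X)"
  by (rule cpoly_subst_hom[OF pconst_hom])

lemma subst_pconst_Const: "cpoly_subst (\<lambda>c. [:c:]) X (Const c) = [:c:]"
  by (rule cpoly_subst_Const[OF pconst_hom])

lemma subst_pconst_Var: "cpoly_subst (\<lambda>c. [:c:]) X (Var v) = X v"
  by (rule cpoly_subst_Var[OF pconst_hom])

lemmas subst_simps = cring_hom.hom_simps[OF subst_pconst_hom] subst_pconst_Const subst_pconst_Var

lemma subst_pev: "cpoly_subst (\<lambda>c. [:c:]) X (pev l f) = pcompose f (cpoly_subst (\<lambda>c. [:c:]) X l)"
  by (induction f) (simp_all add: pev_0 pev_pCons subst_simps pcompose_pCons)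

lemma eval_subst:
  assumes "\<And>v. poly (X v) 0 = x $ v"
  shows "poly (cpoly_subst (\<lambda>c. [:c:]) X p) 0 = cpoly_eval x p"
proof -
  have "cring_hom (\<lambda>p. poly (cpoly_subst (\<lambda>c. [:c:]) X p) 0)"
    by standard (simp_all add: subst_simps)
  from cpoly_hom_eqI[OF this cpoly_eval_hom] show ?thesis
    by (simp add: assms subst_simps eval_simps)
qed

lemma pderiv_sum: "pderiv (sum f A) = (\<Sum>a\<in>A. pderiv (f a))"
  by (induction A rule: infinite_finite_induct) (simp_all add: pderiv_add)

lemma pderiv_subst:
  "pderiv (cpoly_subst (\<lambda>c. [:c:]) X p) =
    (\<Sum>v\<in>UNIV. cpoly_subst (\<lambda>c. [:c:]) X (cpoly_deriv v p) * pderiv (X v))"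
proof -
  let ?\<phi> = "cpoly_subst (\<lambda>c. [:c:]) X"
  have "pderiv (?\<phi> p) = (\<Sum>v\<in>UNIV. ?\<phi> (cpoly_deriv v p) * pderiv (?\<phi> (Var v)))"
    by (rule derivation_chain_rule[OF subst_pconst_hom])
      (simp_all add: subst_simps pderiv_add pderiv_mult pderiv_pCons)
  then show ?thesis by (simp add: subst_simps)
qed

text \<open>The chain rule at parameter 0. It turns vanishing to second order along a curve into a
  null vector of the Jacobian.\<close>

lemma tangent_subst:
  assumes "\<And>v. poly (X v) 0 = x $ v"
  shows "coeff (cpoly_subst (\<lambda>c. [:c:]) X p) 1 =
    (\<Sum>v\<in>UNIV. cpoly_eval x (cpoly_deriv v p) * coeff (X v) 1)"
proof -
  have c1: "coeff f 1 = poly (pderiv f) 0" for f :: "complex poly"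
    by (simp add: poly_0_coeff_0 coeff_pderiv)
  show ?thesis
    unfolding c1 pderiv_subst by (simp add: poly_sum eval_subst[of X x, OF assms])
qed

text \<open>Modulo \<open>J\<close> both sides are ring homomorphisms in \<open>p\<close> that agree
  on the generators.\<close>

lemma subst_congruence:
  assumes J: "ideal.subspace J" and X: "\<And>v. Var v - pev l (X v) \<in> J"
  shows "p - pev l (cpoly_subst (\<lambda>c. [:c:]) X p) \<in> J"
proof (induction p rule: cpoly_induct)
  case (Const c)
  then show ?case using ideal.subspace_0[OF J] by (simp add: subst_simps pev_const)
next
  case (Var v)
  then show ?case using X by (simp add: subst_simps)
next
  case (add p q)
  then show ?case
    using ideal.subspace_add[OF J add] by (simp add: subst_simps pev_simps algebra_simps)
next
  case (mult p q)
  let ?\<phi> = "\<lambda>p. pev l (cpoly_subst (\<lambda>c. [:c:]) X p)"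
  have "p * q - ?\<phi> (p * q) = p * (q - ?\<phi> q) + ?\<phi> q * (p - ?\<phi> p)"
    by (simp add: subst_simps pev_simps algebra_simps)
  then show ?case
    using mult ideal.subspace_add[OF J] ideal.subspace_scale[OF J] by metis
qed

lemma pcompose_dvd_diff:
  fixes u v :: "complex poly"
  assumes "d dvd u - v"
  shows "d dvd pcompose f u - pcompose f v"
proof (induction f)
  case (pCons a f)
  have "pcompose (pCons a f) u - pcompose (pCons a f) v =
      (u - v) * pcompose f u + v * (pcompose f u - pcompose f v)"
    by (simp add: pcompose_pCons algebra_simps)
  with assms pCons show ?case by simp
qed simp

lemma monom_dvd_cancel:
  fixes a b :: "complex poly"
  assumes "monom 1 k dvd a * b" "poly a 0 \<noteq> 0"
  shows "monom 1 k dvd b"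
proof (cases "b = 0")
  case False
  have "a \<noteq> 0" "order 0 a = 0" using assms(2) by (auto simp: order_0I)
  with False assms(1) show ?thesis by (simp add: monom_1_dvd_iff order_mult)
qed simp

lemma monom_dvd_pderiv:
  fixes f :: "complex poly"
  assumes "monom 1 (Suc e) dvd f"
  shows "monom 1 e dvd pderiv f"
  using assms by (simp add: monom_1_dvd_iff' coeff_pderiv)

text \<open>The quotient is C[t]/(t^d): \<open>gen\<close> says that evaluation at \<open>l\<close>
  is onto, \<open>iff\<close> describes its kernel. The basis consists of the powers of
  \<open>l\<close> below \<open>d\<close>.\<close>

lemma has_quotient_dimI:
  assumes Q: "ideal.subspace Q" and gen: "\<And>p. \<exists>f. p - pev l f \<in> Q"
    and iff: "\<And>f. pev l f \<in> Q \<longleftrightarrow> monom 1 d dvd f"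
  shows "has_quotient_dim Q d"
  unfolding has_quotient_dim_def
proof (intro exI[of _ "\<lambda>i. l ^ i"] allI)
  fix p
  define P where "P c = (\<Sum>i<d. monom (c i) i)" for c :: "nat \<Rightarrow> complex"
  have sum: "(\<Sum>i<d. Const (c i) * l ^ i) = pev l (P c)" for c
    unfolding P_def by (simp add: pev_simps pev_monom)
  have coeff_P: "coeff (P c) i = c i" if "i < d" for c i
    using that unfolding P_def by (simp add: coeff_sum)
  show "\<exists>!c. (\<forall>i\<ge>d. c i = 0) \<and> p - (\<Sum>i<d. Const (c i) * l ^ i) \<in> Q"
  proof (rule ex_ex1I)
    obtain f where f: "p - pev l f \<in> Q" using gen by blast
    define c where "c i = (if i < d then coeff f i else 0)" for i
    have "monom 1 d dvd f - P c"
      unfolding monom_1_dvd_iff' by (simp add: coeff_P c_def)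
    then have "pev l (f - P c) \<in> Q" using iff by blast
    from ideal.subspace_add[OF Q f this] have "p - pev l (P c) \<in> Q" by (simp add: pev_simps)
    moreover have "\<forall>i\<ge>d. c i = 0" by (simp add: c_def)
    ultimately show "\<exists>c. (\<forall>i\<ge>d. c i = 0) \<and> p - (\<Sum>i<d. Const (c i) * l ^ i) \<in> Q"
      unfolding sum by (intro exI[of _ c] conjI)
  next
    fix c c'
    assume c: "(\<forall>i\<ge>d. c i = 0) \<and> p - (\<Sum>i<d. Const (c i) * l ^ i) \<in> Q"
      and c': "(\<forall>i\<ge>d. c' i = 0) \<and> p - (\<Sum>i<d. Const (c' i) * l ^ i) \<in> Q"
    then have "(p - pev l (P c')) - (p - pev l (P c)) \<in> Q"
      unfolding sum using ideal.subspace_diff[OF Q] by blast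
    then have "monom 1 d dvd P c - P c'" using iff[of "P c - P c'"] by (simp add: pev_simps)
    then have "c i = c' i" if "i < d" for i
      using that unfolding monom_1_dvd_iff' by (auto simp: coeff_P)
    with c c' show "c = c'" by (metis ext not_le)
  qed
qed

section \<open>Invariance of the dimension of a quotient\<close>

lemma homogeneous_system_solution:
  fixes a :: "'i \<Rightarrow> nat \<Rightarrow> complex"
  assumes "finite I" "m < card I"
  shows "\<exists>c. (\<exists>i\<in>I. c i \<noteq> 0) \<and> (\<forall>i. i \<notin> I \<longrightarrow> c i = 0) \<and> (\<forall>j<m. (\<Sum>i\<in>I. c i * a i j) = 0)"
  using assms
proof (induction m arbitrary: I a)
  case 0
  then obtain k where k: "k \<in> I" by (metis card.empty ex_in_conv less_irrefl)
  then show ?case by (intro exI[of _ "\<lambda>i. if i = k then 1 else 0"]) auto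
next
  case (Suc m)
  show ?case
  proof (cases "\<forall>i\<in>I. a i m = 0")
    case True
    obtain c where c: "\<exists>i\<in>I. c i \<noteq> 0" "\<forall>i. i \<notin> I \<longrightarrow> c i = 0" "\<forall>j<m. (\<Sum>i\<in>I. c i * a i j) = 0"
      using Suc.IH[of I a] Suc.prems by auto
    moreover have "(\<Sum>i\<in>I. c i * a i m) = 0" using True by simp
    ultimately show ?thesis by (intro exI[of _ c]) (auto simp: less_Suc_eq)
  next
    case False
    then obtain k where k: "k \<in> I" "a k m \<noteq> 0" by blast
    \<comment> \<open>Gaussian elimination: equation \<open>m\<close> is solved for the unknown
      \<open>k\<close>, whose value is the one stored in \<open>e\<close> below, and substituted
      into the other equations.\<close>
    define a' where "a' i j = a i j - a i m / a k m * a k j" for i j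
    have "m < card (I - {k})" using Suc.prems k(1) by simp
    then obtain c where c: "\<exists>i\<in>I - {k}. c i \<noteq> 0" "\<forall>i. i \<notin> I - {k} \<longrightarrow> c i = 0"
        "\<forall>j<m. (\<Sum>i\<in>I - {k}. c i * a' i j) = 0"
      using Suc.IH[of "I - {k}" a'] Suc.prems(1) by auto
    define e where "e = c(k := - (\<Sum>i\<in>I - {k}. c i * a i m / a k m))"
    have sum: "(\<Sum>i\<in>I. e i * a i j) = (\<Sum>i\<in>I - {k}. c i * a' i j)" for j
    proof -
      have "(\<Sum>i\<in>I. e i * a i j) = e k * a k j + (\<Sum>i\<in>I - {k}. e i * a i j)"
        using Suc.prems(1) k(1) by (rule sum.remove)
      also have "(\<Sum>i\<in>I - {k}. e i * a i j) = (\<Sum>i\<in>I - {k}. c i * a i j)"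
        by (intro sum.cong) (auto simp: e_def)
      also have "e k * a k j = (\<Sum>i\<in>I - {k}. - (c i * a i m / a k m * a k j))"
        by (simp add: e_def sum_distrib_right sum_negf)
      finally show ?thesis by (simp add: a'_def algebra_simps flip: sum.distrib)
    qed
    have "a' i m = 0" for i using k(2) by (simp add: a'_def)
    then have "\<forall>j<Suc m. (\<Sum>i\<in>I. e i * a i j) = 0"
      unfolding sum using c(3) by (auto simp: less_Suc_eq)
    moreover have "\<exists>i\<in>I. e i \<noteq> 0" "\<forall>i. i \<notin> I \<longrightarrow> e i = 0"
      using c(1,2) k(1) by (auto simp: e_def)
    ultimately show ?thesis by blast
  qed
qed

text \<open>With \<open>n > m\<close>, the \<open>n\<close> basis elements written in the other
  basis satisfy a nontrivial linear relation modulo \<open>Q\<close>, which contradicts the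
  uniqueness of the coordinates of 0.\<close>

lemma has_quotient_dim_le:
  fixes Q :: "'v::finite cpoly set"
  assumes Q: "ideal.subspace Q" and "has_quotient_dim Q m" "has_quotient_dim Q n"
  shows "n \<le> m"
proof (rule ccontr)
  assume "\<not> n \<le> m"
  obtain b where b: "\<forall>p. \<exists>!c. (\<forall>i\<ge>m. c i = 0) \<and> p - (\<Sum>i<m. Const (c i) * b i) \<in> Q"
    using assms(2) unfolding has_quotient_dim_def by (elim exE)
  obtain b' where b': "\<forall>p. \<exists>!c. (\<forall>i\<ge>n. c i = 0) \<and> p - (\<Sum>i<n. Const (c i) * b' i) \<in> Q"
    using assms(3) unfolding has_quotient_dim_def by (elim exE)
  have "\<forall>i. \<exists>c. b' i - (\<Sum>j<m. Const (c j) * b j) \<in> Q"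
  proof
    fix i
    from b have "\<exists>!c. (\<forall>i\<ge>m. c i = 0) \<and> b' i - (\<Sum>j<m. Const (c j) * b j) \<in> Q" by (rule spec)
    then show "\<exists>c. b' i - (\<Sum>j<m. Const (c j) * b j) \<in> Q" by (elim ex1E conjE) (rule exI)
  qed
  from choice[OF this] obtain a where a: "\<forall>i. b' i - (\<Sum>j<m. Const (a i j) * b j) \<in> Q"
    by (elim exE)
  obtain c where c: "\<exists>i\<in>{..<n}. c i \<noteq> 0" "\<forall>i. i \<notin> {..<n} \<longrightarrow> c i = 0"
      "\<forall>j<m. (\<Sum>i<n. c i * a i j) = 0"
    using homogeneous_system_solution[of "{..<n}" m a] \<open>\<not> n \<le> m\<close> by auto
  have "(\<Sum>i<n. Const (c i) * (b' i - (\<Sum>j<m. Const (a i j) * b j))) \<in> Q"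
    using a by (intro ideal.subspace_sum[OF Q] ideal.subspace_scale[OF Q]) simp
  also have "(\<Sum>i<n. Const (c i) * (b' i - (\<Sum>j<m. Const (a i j) * b j))) =
      (\<Sum>i<n. Const (c i) * b' i) - (\<Sum>i<n. \<Sum>j<m. Const (c i * a i j) * b j)"
    by (simp add: right_diff_distrib sum_subtractf sum_distrib_left Const_simps mult.assoc)
  also have "(\<Sum>i<n. \<Sum>j<m. Const (c i * a i j) * b j) =
      (\<Sum>j<m. Const (\<Sum>i<n. c i * a i j) * b j)"
    by (subst sum.swap) (simp add: Const_simps sum_distrib_right)
  also have "\<dots> = 0" using c(3) by (simp add: Const_simps)
  finally have "0 - (\<Sum>i<n. Const (c i) * b' i) \<in> Q"
    using ideal.subspace_neg[OF Q] by fastforce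
  moreover have "0 - (\<Sum>i<n. Const 0 * b' i) \<in> Q"
    using ideal.subspace_0[OF Q] by (simp add: Const_simps)
  moreover have "\<exists>!c. (\<forall>i\<ge>n. c i = 0) \<and> 0 - (\<Sum>i<n. Const (c i) * b' i) \<in> Q"
    using b' by (rule spec)
  then obtain c0 where
    "\<forall>c. (\<forall>i\<ge>n. c i = 0) \<and> 0 - (\<Sum>i<n. Const (c i) * b' i) \<in> Q \<longrightarrow> c = c0"
    by (elim ex1E)
  note this[THEN spec, of c] this[THEN spec, of "\<lambda>_. 0"]
  ultimately have "c = (\<lambda>_. 0)" using c(2) by simp
  then show False using c(1) by simp
qed

lemma has_quotient_dim_unique:
  assumes "ideal.subspace (Q :: 'v::finite cpoly set)" "has_quotient_dim Q m" "has_quotient_dim Q n"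
  shows "m = n"
  using has_quotient_dim_le[OF assms] has_quotient_dim_le[OF assms(1,3,2)] by simp


section \<open>Primary ideals of embedding dimension one\<close>

lemma maximal_ideal_at_ideal: "ideal.subspace (maximal_ideal_at x)"
  unfolding maximal_ideal_at_def by (rule ideal.subspaceI) (simp_all add: eval_simps)

lemma maximal_ideal_at_one: "1 \<notin> maximal_ideal_at x"
  by (simp add: maximal_ideal_at_def eval_simps)

lemma maximal_ideal_at_prime:
  "\<forall>a b. a * b \<in> maximal_ideal_at x \<longrightarrow> a \<in> maximal_ideal_at x \<or> b \<in> maximal_ideal_at x"
  by (simp add: maximal_ideal_at_def eval_simps)

text \<open>There is no conjugation here: \<open>h\<close> enters later through the vector of its
  conjugated entries.\<close>

definition lin_at :: "complex ^ 'v::finite \<Rightarrow> complex ^ 'v \<Rightarrow> 'v cpoly"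
  where "lin_at x a = (\<Sum>v\<in>UNIV. Const (a $ v) * (Var v - Const (x $ v)))"

lemma eval_lin_at: "cpoly_eval y (lin_at x a) = (\<Sum>v\<in>UNIV. a $ v * (y $ v - x $ v))"
  by (simp add: lin_at_def eval_simps)

lemma lin_at_axis: "lin_at x (axis v 1) = Var v - Const (x $ v)"
proof -
  have "Const (axis v 1 $ w) * (Var w - Const (x $ w)) =
      (if w = v then Var w - Const (x $ w) else 0)" for w
    by (simp add: axis_def Const_simps)
  then show ?thesis by (simp add: lin_at_def)
qed

lemma lin_at_add: "lin_at x (a + b) = lin_at x a + lin_at x b"
  by (simp add: lin_at_def Const_simps distrib_right sum.distrib)

lemma lin_at_scale: "lin_at x (c *s a) = Const c * lin_at x a"
  by (simp add: lin_at_def Const_simps sum_distrib_left mult.assoc)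

lemma lin_at_sum: "lin_at x (sum f A) = (\<Sum>k\<in>A. lin_at x (f k))"
  by (induction A rule: infinite_finite_induct)
    (simp_all add: lin_at_add, simp_all add: lin_at_def Const_simps)

text \<open>\<open>L\<close> absorbs the square of the maximal ideal. For a product, the only new
  contribution to the remainder is the product of two differences that vanish at
  \<open>x\<close>.\<close>

lemma taylor_first_order:
  assumes L: "ideal.subspace L"
    and square: "\<And>a b. a \<in> maximal_ideal_at x \<Longrightarrow> b \<in> maximal_ideal_at x \<Longrightarrow> a * b \<in> L"
  shows "p - Const (cpoly_eval x p) - lin_at x (\<chi> v. cpoly_eval x (cpoly_deriv v p)) \<in> L"
proof (induction p rule: cpoly_induct)
  case (Const c)
  then show ?case
    using ideal.subspace_0[OF L] by (simp add: eval_simps cpoly_deriv_Const lin_at_def Const_simps)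
next
  case (Var w)
  have "(\<chi> v. cpoly_eval x (cpoly_deriv v (Var w))) = axis w 1"
    by (simp add: vec_eq_iff axis_def cpoly_deriv_Var eval_simps)
  then show ?case using ideal.subspace_0[OF L] by (simp add: eval_simps lin_at_axis)
next
  case (add p q)
  have "(\<chi> v. cpoly_eval x (cpoly_deriv v (p + q))) =
      (\<chi> v. cpoly_eval x (cpoly_deriv v p)) + (\<chi> v. cpoly_eval x (cpoly_deriv v q))"
    by (simp add: vec_eq_iff cpoly_deriv_add eval_simps)
  then show ?case
    using ideal.subspace_add[OF L add] by (simp add: eval_simps lin_at_add Const_simps algebra_simps)
next
  case (mult p q)
  let ?d = "\<lambda>p. \<chi> v. cpoly_eval x (cpoly_deriv v p)" and ?c = "\<lambda>p. Const (cpoly_eval x p)"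
  have d: "?d (p * q) = cpoly_eval x p *s ?d q + cpoly_eval x q *s ?d p"
    by (simp add: vec_eq_iff cpoly_deriv_mult eval_simps)
  have "p * q - ?c (p * q) - lin_at x (?d (p * q)) =
      (p - ?c p) * (q - ?c q) + ?c p * (q - ?c q - lin_at x (?d q)) +
      ?c q * (p - ?c p - lin_at x (?d p))"
    unfolding d lin_at_add lin_at_scale by (simp add: eval_simps Const_simps algebra_simps)
  moreover have "(p - ?c p) * (q - ?c q) \<in> L"
    by (rule square) (simp_all add: maximal_ideal_at_def eval_simps)
  ultimately show ?case
    using mult ideal.subspace_add[OF L] ideal.subspace_scale[OF L] by metis
qed

text \<open>The linear parts of the equations together with \<open>l\<close> span all linear forms, so the maximal
  ideal is generated by \<open>Q\<close> and \<open>l\<close> up to its square.\<close>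

lemma maximal_ideal_generated:
  fixes F :: "'e::finite \<Rightarrow> 'v::finite cpoly"
  assumes Q: "ideal.subspace Q" "radical Q = maximal_ideal_at x" "\<And>i. F i \<in> Q"
    and ker: "\<And>v. jacobian_at F x *v v = 0 \<Longrightarrow> (\<Sum>j\<in>UNIV. a $ j * v $ j) = 0 \<Longrightarrow> v = 0"
  shows "{q + c * lin_at x a | q c. q \<in> Q} = maximal_ideal_at x" (is "?N = ?M")
proof (rule noetherian_nakayama[OF wf_cpoly_ideals maximal_ideal_at_ideal])
  note N = ideal_add_principal[OF Q(1), of "lin_at x a"]
  have "q \<in> radical Q" if "q \<in> Q" for q
    using that unfolding radical_def by (auto intro!: exI[of _ 1])
  then have QM: "q \<in> ?M" if "q \<in> Q" for q using that Q(2) by simp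
  have l: "lin_at x a \<in> ?M" by (simp add: maximal_ideal_at_def eval_lin_at)
  show "ideal.subspace ?N" by (rule N(1))
  show "?N \<subseteq> ?M"
    using QM ideal.subspace_scale[OF maximal_ideal_at_ideal l]
    by (auto intro: ideal.subspace_add[OF maximal_ideal_at_ideal])
  show "?M \<subseteq> radical ?N" using N(2) Q(2) unfolding radical_def by blast
  fix L assume L: "ideal.subspace L" "?N \<subseteq> L" "\<And>a b. a \<in> ?M \<Longrightarrow> b \<in> ?M \<Longrightarrow> a * b \<in> L"
  \<comment> \<open>The Jacobian with \<open>a\<close> as an additional row. Its kernel is trivial
    by \<open>ker\<close>, so a left inverse \<open>B\<close> expresses every coordinate form
    through the rows, whose linear forms lie in \<open>L\<close>.\<close>
  define A :: "complex ^ 'v ^ 'e option"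
    where "A = (\<chi> k. case k of None \<Rightarrow> a | Some i \<Rightarrow> jacobian_at F x $ i)"
  have A: "lin_at x (A $ k) \<in> L" for k
  proof (cases k)
    case None
    then show ?thesis using N(3) L(2) by (auto simp: A_def)
  next
    case (Some i)
    have "F i \<in> L" using Q(3) N(2) L(2) by blast
    moreover have "cpoly_eval x (F i) = 0" using QM[OF Q(3)] by (simp add: maximal_ideal_at_def)
    ultimately have "F i - (F i - Const (cpoly_eval x (F i)) -
        lin_at x (\<chi> v. cpoly_eval x (cpoly_deriv v (F i)))) \<in> L"
      using taylor_first_order[where x = x and p = "F i", OF L(1,3)] ideal.subspace_diff[OF L(1)] by blast
    moreover have "A $ k = (\<chi> v. cpoly_eval x (cpoly_deriv v (F i)))"
      by (simp add: A_def Some jacobian_at_def)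
    ultimately show ?thesis using \<open>cpoly_eval x (F i) = 0\<close> by (simp add: Const_simps)
  qed
  have "v = 0" if "A *v v = 0" for v
  proof (rule ker)
    have Av: "(A *v v) $ k = 0" for k using that by simp
    show "jacobian_at F x *v v = 0"
      using Av[of "Some _"] by (simp add: vec_eq_iff matrix_vector_mult_def A_def)
    show "(\<Sum>j\<in>UNIV. a $ j * v $ j) = 0"
      using Av[of None] by (simp add: matrix_vector_mult_def A_def)
  qed
  then obtain B where B: "B ** A = mat 1" using matrix_left_invertible_ker[of A] by blast
  have lin: "lin_at x b \<in> L" for b
  proof -
    have "axis v 1 = (\<Sum>k\<in>UNIV. B $ v $ k *s A $ k)" for v
      using arg_cong[OF B, of "\<lambda>C. C $ v"]
      by (simp add: vec_eq_iff matrix_matrix_mult_def mat_def axis_def)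
    then have "lin_at x (axis v 1) \<in> L" for v
      using A ideal.subspace_scale[OF L(1)]
      by (simp add: lin_at_sum lin_at_scale ideal.subspace_sum[OF L(1)])
    then show ?thesis
      unfolding lin_at_def[of x b] lin_at_axis
      by (intro ideal.subspace_sum[OF L(1)] ideal.subspace_scale[OF L(1)])
  qed
  show "?M \<subseteq> L"
  proof
    fix p assume "p \<in> ?M"
    then have p: "p - lin_at x (\<chi> v. cpoly_eval x (cpoly_deriv v p)) \<in> L"
      using taylor_first_order[where x = x and p = p, OF L(1,3)] by (simp add: maximal_ideal_at_def Const_simps)
    from ideal.subspace_add[OF L(1) p lin[of "\<chi> v. cpoly_eval x (cpoly_deriv v p)"]]
    show "p \<in> L" by simp
  qed
qed

text \<open>Expansion in powers of \<open>l\<close>: the value of the remainder at \<open>x\<close>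
  is the next coefficient, and what is left vanishes at \<open>x\<close>, hence is a multiple of
  \<open>l\<close> modulo \<open>Q\<close>.\<close>

lemma power_expansion:
  assumes Q: "ideal.subspace Q" and M: "{q + c * l | q c. q \<in> Q} = maximal_ideal_at x"
  shows "\<exists>f r. p - pev l f - l ^ k * r \<in> Q"
proof (induction k)
  case 0
  have "p - pev l 0 - l ^ 0 * p \<in> Q" using ideal.subspace_0[OF Q] by (simp add: pev_0)
  then show ?case by blast
next
  case (Suc k)
  then obtain f r where fr: "p - pev l f - l ^ k * r \<in> Q" by blast
  let ?c = "cpoly_eval x r"
  have "r - Const ?c \<in> maximal_ideal_at x" by (simp add: maximal_ideal_at_def eval_simps)
  then obtain q s where qs: "r - Const ?c = q + s * l" "q \<in> Q" using M by blast
  have "p - pev l (f + monom ?c k) - l ^ Suc k * s =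
      (p - pev l f - l ^ k * r) + l ^ k * (r - Const ?c - s * l)"
    by (simp add: pev_simps pev_monom algebra_simps)
  also have "\<dots> \<in> Q"
    using fr qs ideal.subspace_add[OF Q] ideal.subspace_scale[OF Q] by simp
  finally show ?case by blast
qed

text \<open>Write \<open>f\<close> as a power of t times \<open>g\<close> with \<open>g\<close>
  nonzero at 0. Then \<open>pev l g\<close> lies outside the radical, so primariness puts that power
  of \<open>l\<close> into \<open>Q\<close>, and \<open>d\<close> is the least such
  exponent.\<close>

lemma primary_pev_iff:
  assumes Q: "primary_ideal Q" "radical Q = maximal_ideal_at x"
    and l: "cpoly_eval x l = 0" and d: "l ^ d \<in> Q" "\<And>k. l ^ k \<in> Q \<Longrightarrow> d \<le> k"
  shows "pev l f \<in> Q \<longleftrightarrow> monom 1 d dvd f"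
proof
  have ideal: "ideal.subspace Q" using Q(1) unfolding primary_ideal_def by blast
  show "pev l f \<in> Q" if f: "monom 1 d dvd f"
  proof -
    obtain g where "f = monom 1 d * g" using f by (rule dvdE)
    then show ?thesis
      using ideal_mult_right[OF ideal d(1)] by (simp add: pev_simps pev_monom Const_simps)
  qed
  assume f: "pev l f \<in> Q"
  show "monom 1 d dvd f"
  proof (cases "f = 0")
    case False
    obtain g where g: "f = [:- 0, 1:] ^ order 0 f * g" "\<not> [:- 0, 1:] dvd g"
      using order_decomp[OF False] by blast
    have "l ^ order 0 f * pev l g \<in> Q"
      using f g(1) pev_simps(7)[of l "[:0, 1:]"] by (metis minus_zero pev_linear pev_simps(2))
    moreover have "pev l g \<notin> radical Q"
      using g(2) by (simp add: Q(2) maximal_ideal_at_def eval_pev l poly_eq_0_iff_dvd)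
    ultimately have "l ^ order 0 f \<in> Q" using Q(1) unfolding primary_ideal_def by blast
    then show ?thesis using d(2) False by (simp add: monom_1_dvd_iff)
  qed simp
qed


section \<open>The augmented system along the curve\<close>

text \<open>Modulo \<open>Q\<close> the coordinates are the polynomials \<open>X j\<close> in the linear form
  \<open>l = h\<^sup>* (\<cdot> - x)\<close>.\<close>

locale curve_component =
  fixes F :: "'n::finite \<Rightarrow> 'n cpoly" and x h :: "complex ^ 'n" and Q :: "'n cpoly set"
    and e :: nat and X :: "'n \<Rightarrow> complex poly" and l :: "'n cpoly"
  defines "l \<equiv> lin_at x (\<chi> j. cnj (h $ j))"
  assumes Q: "ideal.subspace Q" and F_Q: "\<And>i. F i \<in> Q"
    and Q_local: "\<And>q. q \<in> Q \<Longrightarrow> \<exists>s. cpoly_eval x s \<noteq> 0 \<and> s * q \<in> ideal.span (F ` UNIV)"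
    and X_Q: "\<And>j. Var j - pev l (X j) \<in> Q" and X_0: "\<And>j. poly (X j) 0 = x $ j"
    and Q_iff: "\<And>f. pev l f \<in> Q \<longleftrightarrow> monom 1 (Suc e) dvd f" and e: "0 < e"
begin

abbreviation "\<phi> \<equiv> cpoly_subst (\<lambda>c. [:c:]) X"

text \<open>The curve together with its velocity. Differentiation costs one power of t:
  \<open>X\<close> solves the old system modulo t^(e+1), \<open>Y\<close> the new one only modulo
  t^e.\<close>

definition Y :: "'n + 'n \<Rightarrow> complex poly"
  where "Y = case_sum X (\<lambda>j. pderiv (X j))"

abbreviation "\<psi> \<equiv> cpoly_subst (\<lambda>c. [:c:]) Y"

abbreviation "G \<equiv> augmented_system F h"

definition z :: "complex ^ ('n + 'n)"
  where "z = join x (\<chi> j. coeff (X j) 1)"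

text \<open>The candidate for the new primary component: the kernel of restriction to the lifted
  curve, with values in C[t]/(t^e).\<close>

definition K :: "('n + 'n) cpoly set"
  where "K = {p. monom 1 e dvd \<psi> p}"

lemma Y_0: "poly (Y v) 0 = z $ v"
  by (cases v) (simp_all add: Y_def z_def join_def X_0 poly_0_coeff_0[of "pderiv _"] coeff_pderiv)

lemma psi_0: "poly (\<psi> p) 0 = cpoly_eval z p"
  using Y_0 by (rule eval_subst)

lemma psi_in_x: "\<psi> (in_x p) = \<phi> p"
  by (rule cpoly_hom_eqI[OF cring_hom_comp[OF in_x_hom subst_pconst_hom] subst_pconst_hom])
    (simp_all add: in_x_simps subst_simps Y_def)

lemma eval_in_x: "cpoly_eval z (in_x p) = cpoly_eval x p"
  using psi_0[of "in_x p"] eval_subst[of X x p, OF X_0] by (simp add: psi_in_x)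

lemma phi_congruence: "p - pev l (\<phi> p) \<in> Q"
  using Q X_Q by (rule subst_congruence)

lemma Q_phi: "p \<in> Q \<longleftrightarrow> monom 1 (Suc e) dvd \<phi> p"
proof -
  have "p \<in> Q \<longleftrightarrow> pev l (\<phi> p) \<in> Q"
    using phi_congruence[of p] ideal.subspace_diff[OF Q, of p "p - pev l (\<phi> p)"]
      ideal.subspace_add[OF Q, of "p - pev l (\<phi> p)" "pev l (\<phi> p)"] by auto
  then show ?thesis by (simp add: Q_iff)
qed

text \<open>The value of \<open>l\<close> is the parameter of the curve. Its derivative yields the
  equation that normalizes \<open>\<nu>\<close>.\<close>

lemma phi_l: "monom 1 (Suc e) dvd \<phi> l - [:0, 1:]"
proof -
  have "pev l ([:0, 1:] - \<phi> l) \<in> Q"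
    using phi_congruence[of l] by (simp add: pev_simps pev_linear)
  then have "monom 1 (Suc e) dvd - (\<phi> l - [:0, 1:])" by (simp add: Q_iff)
  then show ?thesis by (simp only: dvd_minus_iff)
qed

lemma K_ideal: "ideal.subspace K"
  unfolding K_def by (rule ideal.subspaceI) (simp_all add: subst_simps)

lemma pderiv_phi: "pderiv (\<phi> p) = \<psi> (\<Sum>j\<in>UNIV. in_x (cpoly_deriv j p) * Var (Inr j))"
  by (simp add: pderiv_subst subst_simps psi_in_x) (simp add: Y_def)

lemma phi_l_explicit: "\<phi> l = (\<Sum>j\<in>UNIV. smult (cnj (h $ j)) (X j - [:x $ j:]))"
  by (simp add: l_def lin_at_def subst_simps)

text \<open>Each block restricts to a multiple of t^(e+1) or to the derivative of one.\<close>

lemma augmented_in_K: "G i \<in> K"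
proof -
  consider (F) k where "i = Inl k" | (dF) k where "i = Inr (Inl k)" | (h) u where "i = Inr (Inr u)"
    by (metis sum.exhaust)
  then have "monom 1 e dvd \<psi> (G i)"
  proof cases
    case F
    have "monom 1 e dvd (monom 1 (Suc e) :: complex poly)"
      by (simp add: monom_1_dvd_iff')
    then show ?thesis
      using F_Q[of k] F by (auto simp: augmented_system_def psi_in_x Q_phi intro: dvd_trans)
  next
    case dF
    then have "\<psi> (G i) = pderiv (\<phi> (F k))"
      unfolding pderiv_phi by (simp add: augmented_system_def)
    then show ?thesis using F_Q[of k] by (simp add: Q_phi monom_dvd_pderiv)
  next
    case h
    \<comment> \<open>The subtracted 1 in the last equation is the derivative of the parameter
      t.\<close>
    have "\<psi> (G i) = pderiv (\<phi> l - [:0, 1:])"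
      unfolding h phi_l_explicit
      by (simp add: augmented_system_def subst_simps Y_def pderiv_diff pderiv_sum pderiv_smult
          pderiv_pCons one_pCons)
    then show ?thesis using phi_l by (simp add: monom_dvd_pderiv)
  qed
  then show ?thesis by (simp add: K_def)
qed

lemma augmented_ideal_subset_K: "ideal.span (G ` UNIV) \<subseteq> K"
  using augmented_in_K by (intro ideal.span_minimal K_ideal) blast

text \<open>As \<open>e\<close> is positive, t^e divides some power of a polynomial exactly if its
  constant term vanishes; for \<open>\<psi> p\<close> this term is the value of \<open>p\<close> at
  \<open>z\<close>.\<close>

lemma radical_K: "radical K = maximal_ideal_at z"
proof -
  have root: "poly f 0 = 0 \<longleftrightarrow> (\<exists>k. monom 1 e dvd f ^ k)" for f :: "complex poly"
  proof
    assume "poly f 0 = 0"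
    then have "[:0, 1:] dvd f" by (simp add: poly_eq_0_iff_dvd)
    then have "[:0, 1:] ^ e dvd f ^ e" by (rule dvd_power_same)
    then show "\<exists>k. monom 1 e dvd f ^ k" by (auto simp: monom_altdef)
  next
    assume "\<exists>k. monom 1 e dvd f ^ k"
    then obtain k where "coeff (f ^ k) 0 = 0" using e unfolding monom_1_dvd_iff' by blast
    then show "poly f 0 = 0" by (simp add: poly_power flip: poly_0_coeff_0)
  qed
  show ?thesis
    unfolding radical_def K_def maximal_ideal_at_def
    by (simp add: subst_simps root flip: psi_0)
qed

lemma K_primary: "primary_ideal K"
  unfolding primary_ideal_def
proof (intro conjI allI impI)
  have "K \<noteq> UNIV" using radical_K maximal_ideal_at_one[of z] unfolding radical_def by blast
  then show "1 \<notin> K" using ideal.subspace_scale[OF K_ideal, of 1] by auto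
  fix a b assume ab: "a * b \<in> K"
  show "a \<in> K \<or> b \<in> radical K"
  proof (cases "b \<in> radical K")
    case False
    then have "poly (\<psi> b) 0 \<noteq> 0" by (simp add: radical_K maximal_ideal_at_def psi_0)
    then show ?thesis
      using ab monom_dvd_cancel[of e "\<psi> b" "\<psi> a"] by (simp add: K_def subst_simps mult.commute)
  qed simp
qed (rule K_ideal)

text \<open>The polynomials in the ideal that the augmented system generates in the local ring at
  \<open>z\<close>, with denominators cleared.\<close>

definition S :: "('n + 'n) cpoly set"
  where "S = {p. \<exists>s. cpoly_eval z s \<noteq> 0 \<and> s * p \<in> ideal.span (G ` UNIV)}"

lemma augmented_in_S: "p \<in> ideal.span (G ` UNIV) \<Longrightarrow> p \<in> S"
  unfolding S_def by (auto intro!: exI[of _ 1] simp: eval_simps)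

lemma S_ideal: "ideal.subspace S"
proof (rule ideal.subspaceI)
  show "0 \<in> S" by (intro augmented_in_S ideal.span_zero)
next
  fix p q assume "p \<in> S" "q \<in> S"
  then obtain s t where st: "cpoly_eval z s \<noteq> 0" "s * p \<in> ideal.span (G ` UNIV)"
      "cpoly_eval z t \<noteq> 0" "t * q \<in> ideal.span (G ` UNIV)"
    unfolding S_def by blast
  have "s * t * (p + q) = t * (s * p) + s * (t * q)" by (simp add: algebra_simps)
  also have "\<dots> \<in> ideal.span (G ` UNIV)"
    by (rule ideal.span_add[OF ideal.span_scale[OF st(2)] ideal.span_scale[OF st(4)]])
  finally show "p + q \<in> S"
    unfolding S_def using st(1,3) by (intro CollectI exI[of _ "s * t"]) (simp add: eval_simps)
next
  fix c p assume "p \<in> S"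
  then obtain s where s: "cpoly_eval z s \<noteq> 0" "s * p \<in> ideal.span (G ` UNIV)"
    unfolding S_def by blast
  have "s * (c * p) \<in> ideal.span (G ` UNIV)"
    using ideal.span_scale[OF s(2), of c] by (simp add: ac_simps)
  then show "c * p \<in> S" unfolding S_def using s(1) by blast
qed

lemma S_cancel:
  assumes "s * p \<in> S" "cpoly_eval z s \<noteq> 0"
  shows "p \<in> S"
proof -
  obtain t where "cpoly_eval z t \<noteq> 0" "t * (s * p) \<in> ideal.span (G ` UNIV)"
    using assms(1) unfolding S_def by blast
  then show ?thesis
    unfolding S_def using assms(2)
    by (intro CollectI exI[of _ "t * s"]) (simp add: eval_simps mult.assoc)
qed

text \<open>The universal derivation \<open>d\<close>, with \<open>\<nu>\<^sub>j\<close> in the role of \<open>d x\<^sub>j\<close>.\<close>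

definition D :: "'n cpoly \<Rightarrow> ('n + 'n) cpoly"
  where "D p = (\<Sum>j\<in>UNIV. in_x (cpoly_deriv j p) * Var (Inr j))"

lemma D_add: "D (p + q) = D p + D q"
  by (simp add: D_def cpoly_deriv_add in_x_simps distrib_right sum.distrib)

lemma D_mult: "D (p * q) = in_x p * D q + in_x q * D p"
  by (simp add: D_def cpoly_deriv_mult in_x_simps distrib_right sum.distrib sum_distrib_left
      mult.assoc)

lemma D_Const: "D (Const c) = 0"
  by (simp add: D_def cpoly_deriv_Const in_x_simps)

lemma D_diff: "D (p - q) = D p - D q"
  using D_add[of "p - q" q] by simp

lemma D_Var: "D (Var j) = Var (Inr j)"
proof -
  have "in_x (cpoly_deriv k (Var j)) * Var (Inr k) = (if k = j then Var (Inr j) else 0)" for k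
    by (auto simp: cpoly_deriv_Var in_x_simps Const_simps)
  then show ?thesis by (simp add: D_def)
qed

lemma D_sum: "D (sum f A) = (\<Sum>a\<in>A. D (f a))"
  using D_Const[of 0] by (induction A rule: infinite_finite_induct) (simp_all add: D_add Const_simps)

lemma D_l: "D l = (\<Sum>j\<in>UNIV. Const (cnj (h $ j)) * Var (Inr j))"
  by (simp add: l_def lin_at_def D_sum D_mult D_diff D_Const D_Var in_x_simps)

lemma D_pev: "D (pev p f) = in_x (pev p (pderiv f)) * D p"
proof (induction f)
  case 0
  then show ?case using D_Const[of 0] by (simp add: pev_0 in_x_simps Const_simps)
next
  case (pCons a f)
  then show ?case
    by (simp add: pev_pCons pderiv_pCons pev_add D_add D_mult D_Const in_x_simps Const_simps
        algebra_simps)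
qed

text \<open>By the Leibniz rule the preimage of an ideal under \<open>D\<close> alone need not be an
  ideal, but its intersection with the preimage under \<open>in_x\<close> is. It contains each
  \<open>F i\<close> because the first two blocks are \<open>in_x (F i)\<close> and
  \<open>D (F i)\<close>.\<close>

lemma component_in_S:
  assumes "q \<in> Q"
  shows "in_x q \<in> S" "D q \<in> S"
proof -
  let ?I = "ideal.span (G ` UNIV)"
  let ?T = "{a. in_x a \<in> ?I \<and> D a \<in> ?I}"
  have "ideal.subspace ?T"
  proof (rule ideal.subspaceI)
    show "0 \<in> ?T" using D_Const[of 0] by (simp add: in_x_simps Const_simps ideal.span_zero)
    show "a + b \<in> ?T" if "a \<in> ?T" "b \<in> ?T" for a b
      using that by (simp add: in_x_simps D_add ideal.span_add)
    show "c * a \<in> ?T" if a: "a \<in> ?T" for c a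
    proof -
      have "in_x c * in_x a \<in> ?I" "in_x c * D a + D c * in_x a \<in> ?I"
        using a by (auto intro!: ideal.span_add ideal.span_scale)
      then show ?thesis by (simp add: in_x_simps D_mult mult.commute[of "in_x a" "D c"])
    qed
  qed
  moreover have "F i \<in> ?T" for i
  proof -
    have "in_x (F i) = G (Inl i)" "D (F i) = G (Inr (Inl i))"
      by (simp_all add: augmented_system_def D_def)
    then show ?thesis using ideal.span_base[of _ "G ` UNIV"] by simp
  qed
  ultimately have T: "ideal.span (F ` UNIV) \<subseteq> ?T" by (intro ideal.span_minimal) auto
  obtain s where s: "cpoly_eval x s \<noteq> 0" "s * q \<in> ideal.span (F ` UNIV)"
    using Q_local[OF assms] by blast
  then have "in_x (s * q) \<in> S" "D (s * q) \<in> S" using T augmented_in_S by blast+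
  then have sq: "in_x s * in_x q \<in> S" "in_x s * D q + in_x q * D s \<in> S"
    by (simp_all add: in_x_simps D_mult)
  have s': "cpoly_eval z (in_x s) \<noteq> 0" using s(1) by (simp add: eval_in_x)
  show q: "in_x q \<in> S" using sq(1) s' by (rule S_cancel)
  \<comment> \<open>The Leibniz term \<open>in_x q * D s\<close> is removed by the membership just
    shown.\<close>
  have "in_x s * D q \<in> S"
    using ideal.subspace_diff[OF S_ideal sq(2) ideal_mult_right[OF S_ideal q, of "D s"]] by simp
  then show "D q \<in> S" using s' by (rule S_cancel)
qed

lemma D_l_S: "D l - 1 \<in> S"
proof -
  have "D l - 1 = G (Inr (Inr ()))" by (simp add: augmented_system_def D_l)
  then show ?thesis by (auto intro: augmented_in_S ideal.span_base)
qed

lemma S_mult_D_l: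
  assumes "p - q * D l \<in> S"
  shows "p - q \<in> S"
proof -
  have "p - q = (p - q * D l) + q * (D l - 1)" by (simp add: algebra_simps)
  then show ?thesis
    using assms D_l_S ideal.subspace_add[OF S_ideal] ideal.subspace_scale[OF S_ideal] by metis
qed

lemma Var_congruence: "Var v - pev (in_x l) (Y v) \<in> S"
proof (cases v)
  case (Inl j)
  then show ?thesis
    using component_in_S(1)[OF X_Q[of j]] by (simp add: in_x_simps in_x_pev Y_def)
next
  case (Inr j)
  have "Var (Inr j) - pev (in_x l) (pderiv (X j)) * D l \<in> S"
    using component_in_S(2)[OF X_Q[of j]] by (simp add: D_diff D_Var D_pev in_x_pev)
  then show ?thesis using Inr S_mult_D_l by (simp add: Y_def)
qed

lemma psi_congruence: "p - pev (in_x l) (\<psi> p) \<in> S"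
  using S_ideal Var_congruence by (rule subst_congruence)

text \<open>Differentiating \<open>l ^ (e + 1) \<in> Q\<close> lowers the exponent by one because \<open>d l\<close> is a unit.\<close>

lemma power_in_S: "in_x l ^ e \<in> S"
proof -
  have "pev l (monom 1 (Suc e)) \<in> Q" by (simp add: Q_iff)
  from component_in_S(2)[OF this]
  have "0 - (- pev (in_x l) (pderiv (monom 1 (Suc e)))) * D l \<in> S"
    by (simp add: D_pev in_x_pev)
  from S_mult_D_l[OF this] have "Const (of_nat (Suc e)) * in_x l ^ e \<in> S"
    by (simp add: pderiv_monom pev_monom del: of_nat_Suc)
  \<comment> \<open>The factor \<open>Suc e\<close> is a nonzero constant, hence an admissible
    multiplier.\<close>
  then show ?thesis by (rule S_cancel) (simp add: eval_simps del: of_nat_Suc)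
qed

lemma K_subset_S: "K \<subseteq> S"
proof
  fix p assume "p \<in> K"
  then obtain g where "\<psi> p = monom 1 e * g" unfolding K_def by (auto elim: dvdE)
  then have "pev (in_x l) (\<psi> p) \<in> S"
    using ideal_mult_right[OF S_ideal power_in_S] by (simp add: pev_simps pev_monom Const_simps)
  from ideal.subspace_add[OF S_ideal psi_congruence[of p] this] show "p \<in> S" by simp
qed

text \<open>Membership in \<open>S\<close> gives a multiplier for each element separately; a single
  one is needed both for the primary component and for an open set that isolates
  \<open>z\<close>.\<close>

lemma K_multiplier:
  "\<exists>s. cpoly_eval z s \<noteq> 0 \<and> (\<forall>p\<in>K. s * p \<in> ideal.span (G ` UNIV))"
proof -
  have "\<forall>q\<in>K. \<exists>s. s \<notin> maximal_ideal_at z \<and> s * q \<in> ideal.span (G ` UNIV)"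
    using K_subset_S unfolding S_def maximal_ideal_at_def by blast
  from noetherian_common_multiplier[OF wf_cpoly_ideals ideal.subspace_span
      maximal_ideal_at_one maximal_ideal_at_prime this]
  show ?thesis by (simp add: maximal_ideal_at_def)
qed

lemma psi_l: "monom 1 e dvd \<psi> (in_x l) - [:0, 1:]"
proof -
  have "monom 1 e dvd (monom 1 (Suc e) :: complex poly)" by (simp add: monom_1_dvd_iff')
  then show ?thesis using phi_l by (simp only: psi_in_x) (rule dvd_trans)
qed

text \<open>Modulo t^e, restriction to the lifted curve inverts evaluation at \<open>in_x l\<close>,
  because \<open>l\<close> restricts to the parameter.\<close>

lemma psi_pev: "monom 1 e dvd \<psi> (pev (in_x l) f) - f"
  using pcompose_dvd_diff[OF psi_l, of f] by (simp add: subst_pev)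

lemma K_quotient_dim: "has_quotient_dim K e"
proof (rule has_quotient_dimI[OF K_ideal])
  show "\<exists>f. p - pev (in_x l) f \<in> K" for p
  proof
    have "monom 1 e dvd - (\<psi> (pev (in_x l) (\<psi> p)) - \<psi> p)"
      using psi_pev by (simp only: dvd_minus_iff)
    then show "p - pev (in_x l) (\<psi> p) \<in> K" by (simp add: K_def subst_simps)
  qed
  show "pev (in_x l) f \<in> K \<longleftrightarrow> monom 1 e dvd f" for f
    using dvd_add_right_iff[OF psi_pev, of f f] by (simp add: K_def)
qed

lemma augmented_multiplicity: "has_multiplicity G z e"
proof -
  obtain s where s: "cpoly_eval z s \<noteq> 0" "\<And>p. p \<in> K \<Longrightarrow> s * p \<in> ideal.span (G ` UNIV)"
    using K_multiplier by blast
  have "isolated_primary_component (ideal.span (G ` UNIV)) (maximal_ideal_at z) K"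
  proof (rule isolated_primary_componentI[OF wf_cpoly_ideals ideal.subspace_span K_primary
        radical_K augmented_ideal_subset_K maximal_ideal_at_one maximal_ideal_at_prime])
    show "s \<notin> maximal_ideal_at z" using s(1) by (simp add: maximal_ideal_at_def)
  qed (use s(2) in auto)
  then show ?thesis using K_quotient_dim unfolding has_multiplicity_def by blast
qed

section \<open>Isolatedness and tangent vectors of the new solution\<close>

lemma augmented_vanishes: "p \<in> ideal.span (G ` UNIV) \<Longrightarrow> cpoly_eval z p = 0"
  using augmented_ideal_subset_K e psi_0[of p]
  by (auto simp: K_def monom_1_dvd_iff' poly_0_coeff_0[of "\<psi> p"])

lemma augmented_isolated: "isolated_solution G z"
proof -
  obtain s where s: "cpoly_eval z s \<noteq> 0" "\<And>p. p \<in> K \<Longrightarrow> s * p \<in> ideal.span (G ` UNIV)"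
    using K_multiplier by blast
  let ?Z = "{y. \<forall>i. cpoly_eval y (G i) = 0}" and ?T = "{y. cpoly_eval y s \<noteq> 0}"
  have "continuous_on UNIV (\<lambda>y. cpoly_eval y s)"
    unfolding cpoly_eval_def cpoly_subst_def by (intro continuous_intros)
  then have "open ?T" by (intro open_Collect_neq continuous_intros)
  have "G i \<in> ideal.span (G ` UNIV)" for i by (rule ideal.span_base) simp
  then have z: "z \<in> ?Z" using augmented_vanishes by simp
  have "y = z" if y: "y \<in> ?Z" "y \<in> ?T" for y
  proof -
    have zero: "cpoly_eval y p = 0" if "p \<in> ideal.span (G ` UNIV)" for p
    proof -
      have "ideal.span (G ` UNIV) \<subseteq> maximal_ideal_at y"
        using y(1) by (intro ideal.span_minimal maximal_ideal_at_ideal)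
          (auto simp: maximal_ideal_at_def)
      then show ?thesis using that by (auto simp: maximal_ideal_at_def)
    qed
    have "y $ v = z $ v" for v
    proof -
      \<comment> \<open>A solution where \<open>s\<close> is nonzero annihilates all of
        \<open>K\<close>, and \<open>K\<close> contains a power of each coordinate centered at
        \<open>z\<close>.\<close>
      have "Var v - Const (z $ v) \<in> radical K"
        by (simp add: radical_K maximal_ideal_at_def eval_simps)
      then obtain k where "(Var v - Const (z $ v)) ^ k \<in> K" unfolding radical_def by blast
      then have "cpoly_eval y (s * (Var v - Const (z $ v)) ^ k) = 0" using s(2) zero by blast
      then show ?thesis using y(2) by (simp add: eval_simps)
    qed
    then show "y = z" by (simp add: vec_eq_iff)
  qed
  then have "?T \<inter> ?Z = {z}" using z s(1) by blast
  then show ?thesis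
    unfolding isolated_solution_def isolated_in_def using \<open>open ?T\<close> z by blast
qed

lemma tangent_kernel: "jacobian_at F x *v (\<chi> j. coeff (X j) 1) = 0"
proof -
  have "coeff (\<phi> (F i)) 1 = 0" for i
    using F_Q[of i] e by (simp add: Q_phi monom_1_dvd_iff')
  then show ?thesis
    using tangent_subst[of X x, OF X_0]
    by (simp add: vec_eq_iff matrix_vector_mult_def jacobian_at_def)
qed

text \<open>With \<open>tangent_kernel\<close> this determines the velocity of the curve once the
  kernel is one-dimensional.\<close>

lemma tangent_normalized: "hermitian_prod h (\<chi> j. coeff (X j) 1) = 1"
proof -
  have "coeff (\<phi> l - [:0, 1:]) 1 = 0" using phi_l e by (simp add: monom_1_dvd_iff' del: coeff_diff)
  then show ?thesis
    by (simp add: phi_l_explicit hermitian_prod_def coeff_sum)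
qed

text \<open>From \<open>e = 2\<close> on, the lifted curve meets every equation to second order, so
  its velocity is a null vector. It is nonzero because its first half is the velocity of
  \<open>X\<close>, which is normalized by \<open>h\<close>.\<close>

lemma augmented_singular:
  assumes "1 < e"
  shows "singular_at G z"
proof -
  let ?w = "\<chi> v. coeff (Y v) 1"
  have "coeff (\<psi> (G i)) 1 = 0" for i
    using augmented_in_K[of i] assms by (simp add: K_def monom_1_dvd_iff')
  then have "jacobian_at G z *v ?w = 0"
    using tangent_subst[of Y z, OF Y_0]
    by (simp add: vec_eq_iff matrix_vector_mult_def jacobian_at_def)
  moreover have "?w \<noteq> 0"
  proof
    assume "?w = 0"
    then have "coeff (Y (Inl j)) 1 = 0" for j by (simp add: vec_eq_iff)
    then show False using tangent_normalized by (simp add: Y_def hermitian_prod_def)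
  qed
  ultimately have "\<not> {v. jacobian_at G z *v v = 0} \<subseteq> {0}" by blast
  moreover have "{v. jacobian_at G z *v v = 0} \<subseteq> vec.span {}"
    if "vec.dim {v. jacobian_at G z *v v = 0} = 0"
    by (rule vec.card_ge_dim_independent) (simp_all add: that vec.independent_empty)
  ultimately show ?thesis unfolding singular_at_def corank_def by auto
qed

end

section \<open>The solution of corank one\<close>

lemma corank_one_parallel:
  assumes "corank A = 1" "A *v r = 0" "r \<noteq> 0" "A *v v = 0"
  obtains c where "v = c *s r"
proof -
  have "{v. A *v v = 0} \<subseteq> vec.span {r}"
    using assms by (intro vec.card_ge_dim_independent) (simp_all add: corank_def)
  then show thesis using assms(4) that by (auto simp: vec.span_singleton)
qed

theorem corollary3p9:
  fixes F :: "'n::finite \<Rightarrow> 'n cpoly" and xe r1 h :: "complex ^ 'n" and \<mu> :: nat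
  assumes "isolated_solution F xe"
    and "singular_at F xe"
    and "has_multiplicity F xe \<mu>"
    and "corank (jacobian_at F xe) = 1"
    and "jacobian_at F xe *v r1 = 0"
    and "norm r1 = 1"
    and "hermitian_prod h r1 \<noteq> 0"
  defines "z \<equiv> join xe (\<chi> j. r1 $ j / hermitian_prod h r1)"
  shows "isolated_solution (augmented_system F h) z \<and>
    has_multiplicity (augmented_system F h) z (\<mu> - 1) \<and>
    (\<mu> - 1 > 1 \<longrightarrow> singular_at (augmented_system F h) z)"
proof -
  let ?M = "maximal_ideal_at xe" and ?I = "ideal.span (F ` UNIV)"
  define a :: "complex ^ 'n" where "a = (\<chi> j. cnj (h $ j))"
  define l where "l = lin_at xe a"
  have a: "(\<Sum>j\<in>UNIV. a $ j * v $ j) = hermitian_prod h v" for v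
    by (simp add: a_def hermitian_prod_def)
  have r1: "r1 \<noteq> 0" using assms(6) by auto
  obtain Q where comp: "isolated_primary_component ?I ?M Q" and dim: "has_quotient_dim Q \<mu>"
    using assms(3) unfolding has_multiplicity_def by blast
  note Q = isolated_primary_component_local[OF comp maximal_ideal_at_one maximal_ideal_at_prime]
  have Q_ideal: "ideal.subspace Q" using Q(1) unfolding primary_ideal_def by blast
  have F_Q: "F i \<in> Q" for i using Q(3) ideal.span_base[of "F i" "F ` UNIV"] by auto
  have Q_local: "\<exists>s. cpoly_eval xe s \<noteq> 0 \<and> s * q \<in> ?I" if "q \<in> Q" for q
    using Q(4) that by (auto simp: maximal_ideal_at_def)
  have F_0: "cpoly_eval xe (F i) = 0" for i
  proof -
    have "F i \<in> radical Q" using F_Q[of i] unfolding radical_def by (auto intro!: exI[of _ 1])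
    then show ?thesis by (simp add: Q(2) maximal_ideal_at_def)
  qed
  \<comment> \<open>Null vectors are multiples of \<open>r1\<close>, and \<open>h\<close> does not
    annihilate \<open>r1\<close>; so \<open>l\<close> supplies the one direction missing from the
    Jacobian.\<close>
  have ker: "v = 0" if v: "jacobian_at F xe *v v = 0" "(\<Sum>j\<in>UNIV. a $ j * v $ j) = 0" for v
  proof -
    obtain c where c: "v = c *s r1" using corank_one_parallel[OF assms(4,5) r1 v(1)] .
    have "hermitian_prod h v = c * hermitian_prod h r1"
      by (simp add: c hermitian_prod_def sum_distrib_left ac_simps)
    then have "c = 0" using v(2) assms(7) unfolding a by simp
    then show "v = 0" using c by simp
  qed
  have M: "{q + c * l | q c. q \<in> Q} = ?M"
    unfolding l_def using Q_ideal Q(2) F_Q ker by (rule maximal_ideal_generated)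
  have l_0: "cpoly_eval xe l = 0" by (simp add: l_def eval_lin_at)
  then have "l \<in> radical Q" by (simp add: Q(2) maximal_ideal_at_def)
  then have "\<exists>d. l ^ d \<in> Q" unfolding radical_def by simp
  \<comment> \<open>The nilpotency exponent of \<open>l\<close> modulo \<open>Q\<close>, which turns
    out to be the multiplicity.\<close>
  then obtain d where d: "l ^ d \<in> Q" "\<And>k. l ^ k \<in> Q \<Longrightarrow> d \<le> k"
    using LeastI_ex[of "\<lambda>d. l ^ d \<in> Q"] Least_le[of "\<lambda>d. l ^ d \<in> Q"] by metis
  note Q_iff = primary_pev_iff[OF Q(1,2) l_0 d]
  have gen: "\<exists>f. p - pev l f \<in> Q" for p
  proof -
    obtain f r where "p - pev l f - l ^ d * r \<in> Q" using power_expansion[OF Q_ideal M] by blast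
    from ideal.subspace_add[OF Q_ideal this ideal_mult_right[OF Q_ideal d(1), of r]]
    show ?thesis by auto
  qed
  have "\<mu> = d"
    using Q_ideal dim has_quotient_dimI[OF Q_ideal gen Q_iff] by (rule has_quotient_dim_unique)
  \<comment> \<open>\<open>l\<close> is not in \<open>Q\<close> because \<open>Q\<close> vanishes to second order along \<open>r1\<close>\<close>
  have "\<not> d \<le> 1"
  proof
    assume "d \<le> 1"
    then have "monom 1 d dvd [:0, 1 :: complex:]"
      by (auto simp: monom_1_dvd_iff' coeff_pCons split: nat.splits)
    then have "l \<in> Q" using Q_iff[of "[:0, 1:]"] by (simp add: pev_linear)
    then obtain s where s: "cpoly_eval xe s \<noteq> 0" "s * l \<in> ?I" using Q_local by blast
    \<comment> \<open>The straight line through \<open>xe\<close> in direction \<open>r1\<close>. A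
      multiplier with nonzero value at \<open>xe\<close> cannot raise the vanishing order of
      \<open>l\<close> along it, which is 1.\<close>
    define R where "R j = [:xe $ j, r1 $ j:]" for j
    let ?\<rho> = "cpoly_subst (\<lambda>c. [:c:]) R"
    have R_0: "poly (R j) 0 = xe $ j" for j by (simp add: R_def)
    have "?\<rho> (s * l) \<in> {f. monom 1 2 dvd f}"
    proof (rule cring_hom.span_into_ideal[OF subst_pconst_hom s(2)])
      show "ideal.subspace {f :: complex poly. monom 1 2 dvd f}" by (rule ideal.subspaceI) auto
      fix f assume "f \<in> F ` UNIV"
      then obtain i where f: "f = F i" by blast
      have "coeff (?\<rho> (F i)) 0 = 0"
        using eval_subst[of R xe, OF R_0] F_0 by (simp flip: poly_0_coeff_0)
      moreover have "coeff (?\<rho> (F i)) 1 = (jacobian_at F xe *v r1) $ i"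
        unfolding tangent_subst[of R xe, OF R_0]
        by (simp add: R_def jacobian_at_def matrix_vector_mult_def)
      ultimately show "?\<rho> f \<in> {f. monom 1 2 dvd f}"
        by (simp add: f monom_1_dvd_iff' assms(5) numeral_2_eq_2 less_Suc_eq)
    qed
    then have "monom 1 2 dvd ?\<rho> s * ?\<rho> l" by (simp add: subst_simps)
    moreover have "poly (?\<rho> s) 0 \<noteq> 0" using s(1) eval_subst[of R xe, OF R_0] by simp
    ultimately have "coeff (?\<rho> l) 1 = 0"
      using monom_dvd_cancel by (fastforce simp: monom_1_dvd_iff')
    moreover have "coeff (?\<rho> l) 1 = hermitian_prod h r1"
      by (simp add: l_def lin_at_def subst_simps R_def a[symmetric] coeff_sum mult.commute)
    ultimately show False using assms(7) by simp
  qed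
  \<comment> \<open>Thus \<open>e\<close> is \<open>\<mu> - 1\<close>; its positivity makes the new
    point a solution at all.\<close>
  then obtain e where d_e: "d = Suc e" "0 < e" by (cases d) auto
  have "\<exists>f. Var j - pev l f \<in> Q" for j by (rule gen)
  then obtain X where X: "\<And>j. Var j - pev l (X j) \<in> Q" by metis
  have X_0: "poly (X j) 0 = xe $ j" for j
  proof -
    have "Var j - pev l (X j) \<in> radical Q"
      using X[of j] unfolding radical_def by (auto intro!: exI[of _ 1])
    then show ?thesis by (simp add: Q(2) maximal_ideal_at_def eval_simps eval_pev l_0)
  qed
  interpret curve_component F xe h Q e X l
    using Q_ideal F_Q Q_local X X_0 Q_iff d_e
    by unfold_locales (simp_all add: l_def a_def)
  \<comment> \<open>The velocity is a null vector, hence a multiple of \<open>r1\<close>, and the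
    normalization by \<open>h\<close> fixes the factor.\<close>
  obtain c where c: "(\<chi> j. coeff (X j) 1) = c *s r1"
    using corank_one_parallel[OF assms(4,5) r1 tangent_kernel] .
  have "c * hermitian_prod h r1 = hermitian_prod h (c *s r1)"
    by (simp add: hermitian_prod_def sum_distrib_left ac_simps)
  then have "c = 1 / hermitian_prod h r1"
    using tangent_normalized assms(7) unfolding c by (simp add: field_simps)
  then have "curve_component.z xe X = z"
    unfolding z_def assms(8) c by (simp add: vector_scalar_mult_def)
  then show ?thesis
    using augmented_isolated augmented_multiplicity augmented_singular \<open>\<mu> = d\<close> d_e(1) by simp
qed

end
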